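(* Let $K=\mathbb R$ or an algebraically closed field of characteristic zero. There is no universal TWG-stratification with respect to the polynomial $\tilde f=u\cdot x^2+2w^2\cdot x\cdot y+v\cdot y^2$ on $K^5$ (with coordinates $x,y,u,v,w$).
   Context: $\mathrm{Sing}(\tilde f)$ is the set of points of $\tilde f^{-1}(0)$ at which $d\tilde f=0$. The topology is Zariski by default; for $K=\mathbb R$ or $\mathbb C$ limits are Euclidean. $V\perp T$ for $V\subset(K^5)^*$, $T\subset K^5$ means that elements of $V$ vanish on $T$. An irreducible component of a constructible set is its intersection with an irreducible component of its closure. A set $S$ open in its closure is G-regular (Gauss regular) if its Gauss map $x\mapsto T_x(S)$ on nonsingular points extends continuously (uniquely) to $S$; the extended value at $a$ is denoted $T_a(S)$. A TWG-stratification (with respect to $\tilde f$) is a finite partition of $\mathrm{Sing}(\tilde f)$ into pairwise disjoint G-regular constructible sets $S_i$, open in their closures (neither irreducibility nor the frontier condition is required), satisfying: (Thom) if noncritical points $x_m$ converge to $x_0\in S_i$ and the lines $\mathrm{Span}\{d\tilde f(x_m)\}$ converge to a line $V$, then $V\perp T_{x_0}(S_i)$; (Whitney-a) if $x_m\in S_i$, $x_m\to x_0\in S_j$ and $T_{x_m}(S_i)\to W$, then $W\supset T_{x_0}(S_j)$. A TWG-stratification $\{S_i\}$ is universal if for every irreducible component $S$ of every $S_i$ and any TWG-stratification $\{S'_j\}$ there is a $j$ and an irreducible component $S'$ of $S'_j$ with $S\cap S'$ open and dense in both $S$ and $S'$. *)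

theory Defs
  imports "HOL-Analysis.Analysis" "HOL-Computational_Algebra.Polynomial"
begin

section \<open>Polynomial functions and the Zariski topology\<close>

text \<open>
  The polynomial functions on a type whose coordinate functions are the members of \<open>C\<close>.
  Only infinite fields occur below, so these functions are the polynomials in the coordinates.
\<close>

inductive_set polyfuns :: "('b \<Rightarrow> 'a::comm_ring_1) set \<Rightarrow> ('b \<Rightarrow> 'a) set"
  for C :: "('b \<Rightarrow> 'a) set" where
  const: "(\<lambda>_. c) \<in> polyfuns C"
| coord: "p \<in> C \<Longrightarrow> p \<in> polyfuns C"
| add: "p \<in> polyfuns C \<Longrightarrow> q \<in> polyfuns C \<Longrightarrow> (\<lambda>x. p x + q x) \<in> polyfuns C"
| mult: "p \<in> polyfuns C \<Longrightarrow> q \<in> polyfuns C \<Longrightarrow> (\<lambda>x. p x * q x) \<in> polyfuns C"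

definition zariski_on :: "('b \<Rightarrow> 'a::comm_ring_1) set \<Rightarrow> 'b topology" where
  "zariski_on C = topology_generated_by {{x. p x \<noteq> 0} |p. p \<in> polyfuns C}"

definition vec_coords :: "('a ^ 'n \<Rightarrow> 'a) set" where
  "vec_coords = range (\<lambda>i x. x $ i)"

definition vec_mat_coords :: "(('a ^ 'n) \<times> ('a ^ 'n ^ 'n) \<Rightarrow> 'a) set" where
  "vec_mat_coords = range (\<lambda>i (x, M). x $ i) \<union> range (\<lambda>(i, j) (x, M). M $ i $ j)"

abbreviation vpolys :: "('a::field ^ 'n \<Rightarrow> 'a) set" where
  "vpolys \<equiv> polyfuns vec_coords"

abbreviation zariski :: "('a::field ^ 'n) topology" where
  "zariski \<equiv> zariski_on vec_coords"

inductive constructible :: "('a::field ^ 'n) set \<Rightarrow> bool" where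
  closed: "closedin zariski S \<Longrightarrow> constructible S"
| compl: "constructible S \<Longrightarrow> constructible (- S)"
| union: "constructible S \<Longrightarrow> constructible S' \<Longrightarrow> constructible (S \<union> S')"

definition open_in_closure :: "('a::field ^ 'n) set \<Rightarrow> bool" where
  "open_in_closure S \<longleftrightarrow> openin (subtopology zariski (zariski closure_of S)) S"

definition irreducible_set :: "('a::field ^ 'n) set \<Rightarrow> bool" where
  "irreducible_set S \<longleftrightarrow> S \<noteq> {} \<and>
     (\<forall>A B. closedin zariski A \<longrightarrow> closedin zariski B \<longrightarrow> S \<subseteq> A \<union> B \<longrightarrow> S \<subseteq> A \<or> S \<subseteq> B)"

definition closed_components :: "('a::field ^ 'n) set \<Rightarrow> ('a ^ 'n) set set" where
  "closed_components Z =
     {C. irreducible_set C \<and> C \<subseteq> Z \<and> (\<forall>D. irreducible_set D \<longrightarrow> C \<subseteq> D \<longrightarrow> D \<subseteq> Z \<longrightarrow> D = C)}"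

definition components_of_constructible :: "('a::field ^ 'n) set \<Rightarrow> ('a ^ 'n) set set" where
  "components_of_constructible S = {S \<inter> C |C. C \<in> closed_components (zariski closure_of S)}"

definition open_dense_in :: "('a::field ^ 'n) set \<Rightarrow> ('a ^ 'n) set \<Rightarrow> bool" where
  "open_dense_in U S \<longleftrightarrow> openin (subtopology zariski S) U \<and> S \<subseteq> zariski closure_of U"


section \<open>Differentials, tangent spaces, nonsingular points\<close>

text \<open>
  The formal directional derivative of a polynomial function: the coefficient of \<open>t\<close> in the
  one-variable polynomial \<open>p (x + t v)\<close>, which is unique since the field is infinite.
\<close>

definition dir_deriv :: "('a::field ^ 'n \<Rightarrow> 'a) \<Rightarrow> 'a ^ 'n \<Rightarrow> 'a ^ 'n \<Rightarrow> 'a" where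
  "dir_deriv p x v = (THE d. \<exists>q. (\<forall>t. poly q t = p (x + t *s v)) \<and> d = coeff q 1)"

text \<open>Covectors, elements of the dual space, are written in the dual coordinates.\<close>

definition differential :: "('a::field ^ 'n \<Rightarrow> 'a) \<Rightarrow> 'a ^ 'n \<Rightarrow> 'a ^ 'n" where
  "differential p x = (\<chi> i. dir_deriv p x (axis i 1))"

definition pairing :: "'a::field ^ 'n \<Rightarrow> 'a ^ 'n \<Rightarrow> 'a" where
  "pairing \<xi> v = (\<Sum>i\<in>UNIV. \<xi> $ i * v $ i)"

definition annihilates :: "('a::field ^ 'n) set \<Rightarrow> ('a ^ 'n) set \<Rightarrow> bool" where
  "annihilates V T \<longleftrightarrow> (\<forall>\<xi>\<in>V. \<forall>v\<in>T. pairing \<xi> v = 0)"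

definition tangent_space :: "('a::field ^ 'n) set \<Rightarrow> 'a ^ 'n \<Rightarrow> ('a ^ 'n) set" where
  "tangent_space S x =
     {v. \<forall>p\<in>vpolys. (\<forall>y\<in>S. p y = 0) \<longrightarrow> pairing (differential p x) v = 0}"

text \<open>
  Jacobian criterion: near \<open>x\<close>, the set \<open>S\<close> is cut out by polynomials whose differentials at \<open>x\<close>
  are linearly independent.  For \<open>F = {}\<close> this says that \<open>S\<close> contains a neighbourhood of \<open>x\<close>.
\<close>

definition nonsingular_point :: "('a::field ^ 'n) set \<Rightarrow> 'a ^ 'n \<Rightarrow> bool" where
  "nonsingular_point S x \<longleftrightarrow> x \<in> S \<and>
     (\<exists>U F. openin zariski U \<and> x \<in> U \<and> finite F \<and> F \<subseteq> vpolys \<and>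
        S \<inter> U = {y \<in> U. \<forall>p\<in>F. p y = 0} \<and>
        inj_on (\<lambda>p. differential p x) F \<and> vec.independent ((\<lambda>p. differential p x) ` F))"

definition Sing :: "('a::field ^ 'n \<Rightarrow> 'a) \<Rightarrow> ('a ^ 'n) set" where
  "Sing f = {x. f x = 0 \<and> differential f x = 0}"


section \<open>Limits of pairs (point, linear subspace)\<close>

text \<open>
  A subspace is represented by any square matrix whose rows span it.  On matrices of fixed rank
  the row space map to the Grassmannian is an open surjection, for the Euclidean as well as for
  the Zariski topology, and has local sections; so convergence and closures in the Grassmannian
  can be expressed through such matrices, provided the dimension is kept fixed.
\<close>

definition row_space :: "'a::field ^ 'n ^ 'n \<Rightarrow> ('a ^ 'n) set" where
  "row_space M = vec.span (rows M)"

definition subspace_tendsto ::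
    "(nat \<Rightarrow> ('a::real_normed_field ^ 'n) set) \<Rightarrow> ('a ^ 'n) set \<Rightarrow> bool" where
  "subspace_tendsto V W \<longleftrightarrow>
     (\<forall>\<^sub>F m in sequentially. vec.dim (V m) = vec.dim W) \<and>
     (\<exists>M N. (\<forall>m. V m = row_space (M m)) \<and> W = row_space N \<and> M \<longlonglongrightarrow> N)"

text \<open>
  A limit notion \<open>L A a W\<close> says that \<open>(a, W)\<close> is a limit of members of the set \<open>A\<close> of pairs.
  For the real and the complex numbers these are limits of sequences.  Over a general
  algebraically closed field a limit is a point of the Zariski closure of \<open>A\<close> in the product of
  the affine space with the Grassmannian.
\<close>

type_synonym ('a, 'n) limit_notion =
  "(('a ^ 'n) \<times> ('a ^ 'n) set) set \<Rightarrow> 'a ^ 'n \<Rightarrow> ('a ^ 'n) set \<Rightarrow> bool"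

definition euclidean_limit :: "('a::real_normed_field, 'n::finite) limit_notion" where
  "euclidean_limit A a W \<longleftrightarrow>
     (\<exists>x V. (\<forall>m. (x m, V m) \<in> A) \<and> x \<longlonglongrightarrow> a \<and> subspace_tendsto V W)"

definition zariski_limit :: "('a::field, 'n::finite) limit_notion" where
  "zariski_limit A a W \<longleftrightarrow>
     (\<exists>N. W = row_space N \<and>
        (a, N) \<in> zariski_on vec_mat_coords closure_of
          {(x, M). (x, row_space M) \<in> A \<and> vec.dim (row_space M) = vec.dim W})"


section \<open>Gauss regular sets and TWG-stratifications\<close>

text \<open>
  Continuity of \<open>T\<close>, a map to the (compact, respectively complete) Grassmannian, is expressed by
  closedness of its graph.  Over the real and complex numbers this is equivalent to sequential
  continuity.  Over a general field, mere continuity for the Zariski topologies would be too weak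
  (every finite-to-one map between curves has it).  The last conjunct only normalises the function
  \<open>T\<close> outside \<open>S\<close>.
\<close>

definition gauss_extension ::
    "('a::field, 'n::finite) limit_notion \<Rightarrow> ('a ^ 'n) set \<Rightarrow> ('a ^ 'n \<Rightarrow> ('a ^ 'n) set) \<Rightarrow> bool" where
  "gauss_extension L S T \<longleftrightarrow>
     (\<forall>x\<in>S. vec.subspace (T x)) \<and>
     (\<forall>x. nonsingular_point S x \<longrightarrow> T x = tangent_space S x) \<and>
     (\<forall>a\<in>S. \<forall>W. L {(x, T x) |x. x \<in> S} a W \<longrightarrow> W = T a) \<and>
     T \<in> extensional S"

definition G_regular :: "('a::field, 'n::finite) limit_notion \<Rightarrow> ('a ^ 'n) set \<Rightarrow> bool" where
  "G_regular L S \<longleftrightarrow> open_in_closure S \<and> (\<exists>!T. gauss_extension L S T)"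

definition gauss_tangent ::
    "('a::field, 'n::finite) limit_notion \<Rightarrow> ('a ^ 'n) set \<Rightarrow> 'a ^ 'n \<Rightarrow> ('a ^ 'n) set" where
  "gauss_tangent L S = (THE T. gauss_extension L S T)"

definition thom_condition ::
    "('a::field, 'n::finite) limit_notion \<Rightarrow> ('a ^ 'n \<Rightarrow> 'a) \<Rightarrow> ('a ^ 'n) set \<Rightarrow> bool" where
  "thom_condition L f S \<longleftrightarrow>
     (\<forall>a\<in>S. \<forall>V. L {(x, vec.span {differential f x}) |x. differential f x \<noteq> 0} a V \<longrightarrow>
        annihilates V (gauss_tangent L S a))"

definition whitney_a ::
    "('a::field, 'n::finite) limit_notion \<Rightarrow> ('a ^ 'n) set \<Rightarrow> ('a ^ 'n) set \<Rightarrow> bool" where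
  "whitney_a L S S' \<longleftrightarrow>
     (\<forall>a\<in>S'. \<forall>W. L {(x, gauss_tangent L S x) |x. x \<in> S} a W \<longrightarrow> gauss_tangent L S' a \<subseteq> W)"

definition TWG_stratification ::
    "('a::field, 'n::finite) limit_notion \<Rightarrow> ('a ^ 'n \<Rightarrow> 'a) \<Rightarrow> ('a ^ 'n) set set \<Rightarrow> bool" where
  "TWG_stratification L f P \<longleftrightarrow>
     finite P \<and> partition_on (Sing f) P \<and>
     (\<forall>S\<in>P. constructible S \<and> open_in_closure S \<and> G_regular L S) \<and>
     (\<forall>S\<in>P. thom_condition L f S) \<and>
     (\<forall>S\<in>P. \<forall>S'\<in>P. whitney_a L S S')"

definition universal_TWG_stratification ::
    "('a::field, 'n::finite) limit_notion \<Rightarrow> ('a ^ 'n \<Rightarrow> 'a) \<Rightarrow> ('a ^ 'n) set set \<Rightarrow> bool" where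
  "universal_TWG_stratification L f P \<longleftrightarrow>
     TWG_stratification L f P \<and>
     (\<forall>S\<in>P. \<forall>C\<in>components_of_constructible S. \<forall>P'. TWG_stratification L f P' \<longrightarrow>
        (\<exists>S'\<in>P'. \<exists>C'\<in>components_of_constructible S'.
           open_dense_in (C \<inter> C') C \<and> open_dense_in (C \<inter> C') C'))"


section \<open>The polynomial\<close>

definition poly_xyuvw :: "'a::field ^ 5 \<Rightarrow> 'a" where
  "poly_xyuvw p =
     (let x = p $ 1; y = p $ 2; u = p $ 3; v = p $ 4; w = p $ 5
      in u * x^2 + 2 * w^2 * x * y + v * y^2)"

end

theory Submission
  imports Defs
begin

text \<open>
  The singular locus of \<open>f = u x\<^sup>2 + 2 w\<^sup>2 x y + v y\<^sup>2\<close> is the space \<open>x = y = 0\<close> with coordinates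
  \<open>u, v, w\<close>.  As a quadratic form in \<open>x, y\<close>, \<open>f\<close> degenerates along the surface \<open>u v = w\<^sup>4\<close>, whose only
  singular point is the origin.

  At the origin the Thom condition leaves room for curves tangent to the \<open>w\<close>-axis and for nothing
  larger.  The reason is that the last three partial derivatives are \<open>x\<^sup>2\<close>, \<open>y\<^sup>2\<close> and \<open>4 w x y\<close>: at
  the origin the limits of conormal lines have no \<open>dw\<close>-component, whereas their \<open>du\<close>- and
  \<open>dv\<close>-components need not vanish.  Near the origin the normal vector \<open>(v, u, -4w\<^sup>3)\<close> of the
  surface also loses its last component, since \<open>w\<^sup>4 = u v\<close>, so the surface satisfies Whitney's
  condition (a) along such a curve.  Hence the origin may be a stratum of its own, or it may lie on
  the \<open>w\<close>-axis as a stratum; the rest of the surface and the open complement are the other strata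
  in both cases (\<open>TWG_toric_strata\<close>).

  A component of a universal stratification must have the same closure as a component of each of
  these two stratifications.  The only closures that they share are the whole singular locus and
  the surface, so the stratum through the origin is open in one of these two sets
  (\<open>closure_of_universal_stratum\<close>).  Neither is possible.  The conormal lines along the \<open>x\<close>-axis are
  spanned by \<open>du\<close>, which contradicts the Thom condition for an open subset of the singular locus
  (\<open>not_thom_at_origin\<close>).  The tangent planes of the surface along the \<open>u\<close>-axis and along the
  \<open>v\<close>-axis have different limits, so the surface is not Gauss regular at the origin
  (\<open>not_gauss_regular_at_origin\<close>).

  The argument is the same for all fields of characteristic zero.  A limit of sequences
  is a limit in the Zariski sense, so all conditions on a stratification are verified for Zariski
  limits, from polynomial identities; the limits that contradict universality are
  limits of constant subspaces along lines, which exist for both notions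
  (\<open>algebraic_limit\<close>).
\<close>

section \<open>Zariski topologies\<close>

lemma topspace_zariski_on [simp]: "topspace (zariski_on C) = UNIV"
proof -
  have "UNIV \<in> {{x. p x \<noteq> 0} |p. p \<in> polyfuns C}"
    using polyfuns.const[of 1 C] by (auto intro!: exI[of _ "\<lambda>_. 1"])
  then show ?thesis
    unfolding zariski_on_def topology_generated_by_topspace by blast
qed

lemma openin_nonzero_set:
  assumes "p \<in> polyfuns C"
  shows "openin (zariski_on C) {x. p x \<noteq> 0}"
  unfolding zariski_on_def using assms by (intro topology_generated_by_Basis) blast

lemma closedin_zero_set:
  assumes "p \<in> polyfuns C"
  shows "closedin (zariski_on C) {x. p x = 0}"
proof -
  have "UNIV - {x. p x = 0} = {x. p x \<noteq> 0}" by auto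
  then show ?thesis using openin_nonzero_set[OF assms] by (simp add: closedin_def)
qed

lemma openin_Compl: "closedin (zariski_on C) B \<Longrightarrow> openin (zariski_on C) (- B)"
  by (simp add: closedin_def Compl_eq_Diff_UNIV)

lemma closedin_Compl: "openin (zariski_on C) U \<Longrightarrow> closedin (zariski_on C) (- U)"
  by (simp add: closedin_def Compl_eq_Diff_UNIV double_diff)

text \<open>
  Products of polynomials turn the subbasis of nonvanishing sets into a basis.
\<close>

lemma openin_nonvanishing_nhd:
  assumes "openin (zariski_on C) U" "x \<in> U"
  obtains p where "p \<in> polyfuns C" "p x \<noteq> (0::'a::field)" "\<And>y. p y \<noteq> 0 \<Longrightarrow> y \<in> U"
proof -
  have "generate_topology_on {{x. p x \<noteq> 0} |p. p \<in> polyfuns C} U"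
    using assms(1) by (simp add: zariski_on_def openin_topology_generated_by_iff)
  then have "x \<in> U \<longrightarrow> (\<exists>p\<in>polyfuns C. p x \<noteq> 0 \<and> (\<forall>y. p y \<noteq> 0 \<longrightarrow> y \<in> U))"
  proof induction
    case (Int V W)
    show ?case
    proof
      assume "x \<in> V \<inter> W"
      then obtain p q where "p \<in> polyfuns C" "p x \<noteq> 0" "\<forall>y. p y \<noteq> 0 \<longrightarrow> y \<in> V"
          "q \<in> polyfuns C" "q x \<noteq> 0" "\<forall>y. q y \<noteq> 0 \<longrightarrow> y \<in> W"
        using Int by blast
      then show "\<exists>p\<in>polyfuns C. p x \<noteq> 0 \<and> (\<forall>y. p y \<noteq> 0 \<longrightarrow> y \<in> V \<inter> W)"
        by (intro bexI[of _ "\<lambda>y. p y * q y"]) (auto intro: polyfuns.mult)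
    qed
  next
    case (UN K)
    show ?case
    proof
      assume "x \<in> \<Union> K"
      then obtain V where V: "V \<in> K" "x \<in> V" by blast
      then obtain p where "p \<in> polyfuns C" "p x \<noteq> 0" "\<forall>y. p y \<noteq> 0 \<longrightarrow> y \<in> V"
        using UN.IH[OF V(1)] by auto
      then show "\<exists>p\<in>polyfuns C. p x \<noteq> 0 \<and> (\<forall>y. p y \<noteq> 0 \<longrightarrow> y \<in> \<Union> K)"
        using V(1) by blast
    qed
  next
    case (Basis s)
    then show ?case by auto
  qed simp
  then show ?thesis using that assms(2) by blast
qed

lemma in_zariski_closure_iff:
  "x \<in> zariski_on C closure_of B \<longleftrightarrow>
     (\<forall>p\<in>polyfuns C. (\<forall>b\<in>B. p b = (0::'a::field)) \<longrightarrow> p x = 0)"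
proof
  assume "x \<in> zariski_on C closure_of B"
  then show "\<forall>p\<in>polyfuns C. (\<forall>b\<in>B. p b = 0) \<longrightarrow> p x = 0"
    using closedin_zero_set closure_of_minimal by (metis (mono_tags, lifting) mem_Collect_eq subsetD subsetI)
next
  assume *: "\<forall>p\<in>polyfuns C. (\<forall>b\<in>B. p b = 0) \<longrightarrow> p x = 0"
  show "x \<in> zariski_on C closure_of B"
    unfolding in_closure_of
  proof (intro conjI allI impI)
    fix T assume "x \<in> T \<and> openin (zariski_on C) T"
    then obtain p where "p \<in> polyfuns C" "p x \<noteq> 0" "\<And>y. p y \<noteq> 0 \<Longrightarrow> y \<in> T"
      using openin_nonvanishing_nhd by metis
    with * show "\<exists>y. y \<in> B \<and> y \<in> T" by blast
  qed simp
qed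

lemma closedin_separating_poly:
  assumes "closedin (zariski_on C) B" "x \<notin> B"
  obtains p where "p \<in> polyfuns C" "p x \<noteq> (0::'a::field)" "\<And>y. y \<in> B \<Longrightarrow> p y = 0"
  using openin_nonvanishing_nhd[OF openin_Compl[OF assms(1)], of x] assms(2) by (metis Compl_iff)

lemma polyfuns_uminus: "p \<in> polyfuns C \<Longrightarrow> (\<lambda>x. - p x) \<in> polyfuns C"
  using polyfuns.mult[OF polyfuns.const[of "-1"], of p C] by simp

lemma polyfuns_diff: "p \<in> polyfuns C \<Longrightarrow> q \<in> polyfuns C \<Longrightarrow> (\<lambda>x. p x - q x) \<in> polyfuns C"
  using polyfuns.add[OF _ polyfuns_uminus, of p C q] by simp

lemma polyfuns_power: "p \<in> polyfuns C \<Longrightarrow> (\<lambda>x. p x ^ n) \<in> polyfuns C"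
  by (induction n) (auto intro: polyfuns.intros)

lemma polyfuns_sum:
  "finite A \<Longrightarrow> (\<And>i. i \<in> A \<Longrightarrow> p i \<in> polyfuns C) \<Longrightarrow> (\<lambda>x. \<Sum>i\<in>A. p i x) \<in> polyfuns C"
  by (induction A rule: finite_induct) (auto intro: polyfuns.intros)

lemma vpolys_coord: "(\<lambda>x. x $ i) \<in> vpolys"
  by (rule polyfuns.coord) (auto simp: vec_coords_def)

lemmas polyfuns_intros = polyfuns.const polyfuns.add polyfuns.mult polyfuns_uminus polyfuns_diff
  polyfuns_power vpolys_coord

lemma vec_mat_polys_entry: "(\<lambda>z. snd z $ i $ j) \<in> polyfuns vec_mat_coords"
proof (rule polyfuns.coord)
  have "(\<lambda>z. snd z $ i $ j) = (\<lambda>(i, j) (x, M). M $ i $ j) (i, j)" by (auto simp: fun_eq_iff)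
  then show "(\<lambda>z. snd z $ i $ j) \<in> vec_mat_coords" unfolding vec_mat_coords_def by blast
qed

lemma vec_mat_polys_fst: "p \<in> vpolys \<Longrightarrow> (\<lambda>z. p (fst z)) \<in> polyfuns vec_mat_coords"
proof (induction p rule: polyfuns.induct)
  case (coord p)
  then obtain i where p: "p = (\<lambda>x. x $ i)" by (auto simp: vec_coords_def)
  have "(\<lambda>z. p (fst z)) = (\<lambda>(x, M). x $ i)" unfolding p by auto
  then have "(\<lambda>z. p (fst z)) \<in> vec_mat_coords" by (auto simp: vec_mat_coords_def)
  then show ?case by (rule polyfuns.coord)
qed (auto intro: polyfuns.intros)


section \<open>Polynomial arcs and differentials\<close>

definition arc :: "('n \<Rightarrow> 'a::field_char_0 poly) \<Rightarrow> 'a \<Rightarrow> 'a ^ 'n" where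
  "arc G t = (\<chi> i. poly (G i) t)"

definition arc_velocity :: "('n \<Rightarrow> 'a::field_char_0 poly) \<Rightarrow> 'a ^ 'n" where
  "arc_velocity G = (\<chi> i. poly (pderiv (G i)) 0)"

lemma arc_nth [simp]: "arc G t $ i = poly (G i) t"
  by (simp add: arc_def)

lemma arc_velocity_nth [simp]: "arc_velocity G $ i = poly (pderiv (G i)) 0"
  by (simp add: arc_velocity_def)

lemma polyfun_comp_poly:
  fixes \<gamma> :: "'a::comm_ring_1 \<Rightarrow> 'b"
  assumes "p \<in> polyfuns C" "\<And>c. c \<in> C \<Longrightarrow> \<exists>q. \<forall>t. c (\<gamma> t) = poly q t"
  shows "\<exists>q. \<forall>t. p (\<gamma> t) = poly q t"
  using assms(1)
proof induction
  case (const c)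
  show ?case by (rule exI[of _ "[:c:]"]) simp
next
  case (coord p)
  then show ?case using assms(2) by blast
next
  case (add p q)
  then obtain r s where "\<forall>t. p (\<gamma> t) = poly r t" "\<forall>t. q (\<gamma> t) = poly s t" by blast
  then show ?case by (intro exI[of _ "r + s"]) simp
next
  case (mult p q)
  then obtain r s where "\<forall>t. p (\<gamma> t) = poly r t" "\<forall>t. q (\<gamma> t) = poly s t" by blast
  then show ?case by (intro exI[of _ "r * s"]) simp
qed

text \<open>
  The formal derivative satisfies the chain rule along every polynomial arc.  The gradient is
  quantified outside the arc, so the straight lines that define the differential determine it.
\<close>

lemma ex_gradient:
  fixes p :: "'a::field_char_0 ^ 'n \<Rightarrow> 'a"
  assumes "p \<in> vpolys"
  shows "\<exists>D. \<forall>G. \<exists>q. (\<forall>t. poly q t = p (arc G t)) \<and>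
           poly (pderiv q) 0 = pairing (D (arc G 0)) (arc_velocity G)"
  using assms
proof induction
  case (const c)
  show ?case
    by (intro exI[of _ "\<lambda>_. 0"] allI exI[of _ "[:c:]"]) (simp add: pairing_def)
next
  case (coord p)
  then obtain i where "p = (\<lambda>x. x $ i)" by (auto simp: vec_coords_def)
  then have "\<exists>q. (\<forall>t. poly q t = p (arc G t)) \<and>
      poly (pderiv q) 0 = pairing (axis i 1) (arc_velocity G)" for G
    by (intro exI[of _ "G i"]) (simp add: pairing_def axis_def if_distrib[of "\<lambda>x. x * _"] cong: if_cong)
  then show ?case by (intro exI[of _ "\<lambda>_. axis i 1"]) blast
next
  case (add p1 p2)
  obtain D1 D2 where
    D1: "\<And>G. \<exists>q. (\<forall>t. poly q t = p1 (arc G t)) \<and> poly (pderiv q) 0 = pairing (D1 (arc G 0)) (arc_velocity G)"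
    and D2: "\<And>G. \<exists>q. (\<forall>t. poly q t = p2 (arc G t)) \<and> poly (pderiv q) 0 = pairing (D2 (arc G 0)) (arc_velocity G)"
    using add.IH by blast
  have "\<exists>q. (\<forall>t. poly q t = p1 (arc G t) + p2 (arc G t)) \<and>
      poly (pderiv q) 0 = pairing (D1 (arc G 0) + D2 (arc G 0)) (arc_velocity G)" for G
  proof -
    obtain q1 where "\<And>t. poly q1 t = p1 (arc G t)"
      "poly (pderiv q1) 0 = pairing (D1 (arc G 0)) (arc_velocity G)" using D1 by blast
    moreover obtain q2 where "\<And>t. poly q2 t = p2 (arc G t)"
      "poly (pderiv q2) 0 = pairing (D2 (arc G 0)) (arc_velocity G)" using D2 by blast
    ultimately show ?thesis
      by (intro exI[of _ "q1 + q2"]) (simp add: pderiv_add pairing_def distrib_right sum.distrib)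
  qed
  then show ?case by (intro exI[of _ "\<lambda>x. D1 x + D2 x"]) blast
next
  case (mult p1 p2)
  obtain D1 D2 where
    D1: "\<And>G. \<exists>q. (\<forall>t. poly q t = p1 (arc G t)) \<and> poly (pderiv q) 0 = pairing (D1 (arc G 0)) (arc_velocity G)"
    and D2: "\<And>G. \<exists>q. (\<forall>t. poly q t = p2 (arc G t)) \<and> poly (pderiv q) 0 = pairing (D2 (arc G 0)) (arc_velocity G)"
    using mult.IH by blast
  have "\<exists>q. (\<forall>t. poly q t = p1 (arc G t) * p2 (arc G t)) \<and>
      poly (pderiv q) 0 =
        pairing (p1 (arc G 0) *s D2 (arc G 0) + p2 (arc G 0) *s D1 (arc G 0)) (arc_velocity G)" for G
  proof -
    obtain q1 where "\<And>t. poly q1 t = p1 (arc G t)"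
      "poly (pderiv q1) 0 = pairing (D1 (arc G 0)) (arc_velocity G)" using D1 by blast
    moreover obtain q2 where "\<And>t. poly q2 t = p2 (arc G t)"
      "poly (pderiv q2) 0 = pairing (D2 (arc G 0)) (arc_velocity G)" using D2 by blast
    ultimately show ?thesis
      by (intro exI[of _ "q1 * q2"])
        (simp add: pderiv_mult pairing_def distrib_right sum.distrib sum_distrib_left mult.assoc)
  qed
  then show ?case by (intro exI[of _ "\<lambda>x. p1 x *s D2 x + p2 x *s D1 x"]) blast
qed

lemma dir_deriv_eqI:
  fixes p :: "'a::field_char_0 ^ 'n \<Rightarrow> 'a"
  assumes "\<And>t. poly q t = p (x + t *s v)"
  shows "dir_deriv p x v = poly (pderiv q) 0"
proof -
  have "q' = q" if "\<forall>t. poly q' t = p (x + t *s v)" for q'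
    using that assms by (simp flip: poly_eq_poly_eq_iff add: fun_eq_iff)
  moreover have "poly (pderiv q) 0 = coeff q 1"
    by (simp add: poly_0_coeff_0 coeff_pderiv)
  ultimately show ?thesis
    unfolding dir_deriv_def using assms by (intro the_equality) auto
qed

lemma arc_line: "arc (\<lambda>i. [:x $ i, v $ i:]) t = x + t *s v"
  by (simp add: vec_eq_iff)

lemma arc_velocity_line: "arc_velocity (\<lambda>i. [:x $ i, v $ i:]) = v"
  by (simp add: vec_eq_iff pderiv_pCons)

lemma pairing_axis [simp]: "pairing \<xi> (axis i 1) = \<xi> $ i"
  by (simp add: pairing_def axis_def if_distrib[of "\<lambda>x. _ * x"] cong: if_cong)

lemma chain_rule_arc:
  fixes p :: "'a::field_char_0 ^ 'n \<Rightarrow> 'a"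
  assumes "p \<in> vpolys" "\<And>t. poly q t = p (arc G t)"
  shows "poly (pderiv q) 0 = pairing (differential p (arc G 0)) (arc_velocity G)"
proof -
  obtain D where D: "\<And>G. \<exists>q. (\<forall>t. poly q t = p (arc G t)) \<and>
           poly (pderiv q) 0 = pairing (D (arc G 0)) (arc_velocity G)"
    using ex_gradient[OF assms(1)] by blast
  have "dir_deriv p x v = pairing (D x) v" for x v
  proof -
    obtain q' where "\<And>t. poly q' t = p (x + t *s v)" "poly (pderiv q') 0 = pairing (D x) v"
      using D[of "\<lambda>i. [:x $ i, v $ i:]"] unfolding arc_line arc_velocity_line by auto
    then show ?thesis using dir_deriv_eqI[of q' p x v] by simp
  qed
  then have "differential p x = D x" for x
    by (simp add: differential_def vec_eq_iff)
  moreover obtain q' where q': "\<And>t. poly q' t = p (arc G t)"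
      "poly (pderiv q') 0 = pairing (D (arc G 0)) (arc_velocity G)"
    using D by blast
  moreover have "q' = q"
    using q'(1) assms(2) by (simp flip: poly_eq_poly_eq_iff add: fun_eq_iff)
  ultimately show ?thesis by simp
qed

lemma differential_eqI:
  fixes p :: "'a::field_char_0 ^ 'n \<Rightarrow> 'a"
  assumes "\<And>i t. poly (q i) t = p (x + t *s axis i 1)" "\<And>i. poly (pderiv (q i)) 0 = \<xi> $ i"
  shows "differential p x = \<xi>"
  using dir_deriv_eqI[OF assms(1)] assms(2) by (simp add: differential_def vec_eq_iff)

lemma differential_coord:
  "differential (\<lambda>x. x $ i) (x::'a::field_char_0 ^ 'n) = axis i 1"
  by (rule differential_eqI[where q = "\<lambda>j. [:x $ i, axis j 1 $ i:]"])
    (auto simp: pderiv_pCons axis_def)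

text \<open>
  A polynomial that vanishes on a set vanishes along every arc in its closure, hence so does its
  derivative along the arc.  This bounds tangent spaces from below.
\<close>

lemma arc_velocity_in_tangent_space:
  fixes S :: "('a::field_char_0 ^ 'n) set"
  assumes "\<And>t. arc G t \<in> zariski closure_of S" "arc G 0 = x" "arc_velocity G = v"
  shows "v \<in> tangent_space S x"
  unfolding tangent_space_def
proof (intro CollectI ballI impI)
  fix p :: "'a ^ 'n \<Rightarrow> 'a" assume p: "p \<in> vpolys" "\<forall>y\<in>S. p y = 0"
  then have "poly 0 t = p (arc G t)" for t
    using assms(1)[of t] unfolding in_zariski_closure_iff by simp
  from chain_rule_arc[OF p(1) this] show "pairing (differential p x) v = 0"
    using assms(2,3) by simp
qed

lemma pairing_add_right: "pairing \<xi> (v + w) = pairing \<xi> v + pairing \<xi> w"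
  by (simp add: pairing_def distrib_left sum.distrib)

lemma pairing_scale_right: "pairing \<xi> (c *s v) = c * pairing \<xi> v"
  by (simp add: pairing_def sum_distrib_left mult.left_commute)

lemma pairing_zero_right [simp]: "pairing \<xi> 0 = 0"
  by (simp add: pairing_def)

lemma pairing_commute: "pairing \<xi> v = pairing v \<xi>"
  by (simp add: pairing_def mult.commute)

lemma subspace_pairing: "vec.subspace {v. pairing \<xi> v = 0}"
  by (auto simp: vec.subspace_def pairing_add_right pairing_scale_right)

lemma subspace_tangent_space: "vec.subspace (tangent_space S x)"
  by (auto simp: tangent_space_def vec.subspace_def pairing_add_right pairing_scale_right)

text \<open>
  Pairing a linear combination with \<open>e p\<close> isolates the coefficient of \<open>\<xi> p\<close>.
\<close>

lemma independent_if_dual_vectors: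
  fixes \<xi> :: "'b \<Rightarrow> 'a::field ^ 'n"
  assumes "finite F" "\<And>p. p \<in> F \<Longrightarrow> pairing (\<xi> p) (e p) \<noteq> 0"
    "\<And>p q. p \<in> F \<Longrightarrow> q \<in> F \<Longrightarrow> p \<noteq> q \<Longrightarrow> pairing (\<xi> q) (e p) = 0"
  shows "inj_on \<xi> F" "vec.independent (\<xi> ` F)"
proof -
  show inj: "inj_on \<xi> F"
  proof (intro inj_onI, rule ccontr)
    fix p q assume "p \<in> F" "q \<in> F" "\<xi> p = \<xi> q" "p \<noteq> q"
    then show False using assms(2)[of p] assms(3)[of p q] by simp
  qed
  show "vec.independent (\<xi> ` F)"
  proof
    assume "vec.dependent (\<xi> ` F)"
    moreover have "finite (\<xi> ` F)" using assms(1) by simp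
    ultimately obtain u w where uw: "w \<in> \<xi> ` F" "u w \<noteq> 0" "(\<Sum>v\<in>\<xi> ` F. u v *s v) = 0"
      unfolding vec.dependent_finite[OF \<open>finite (\<xi> ` F)\<close>] by auto
    then obtain p where p: "p \<in> F" "w = \<xi> p" by blast
    have "(\<Sum>q\<in>F. u (\<xi> q) *s \<xi> q) = 0"
      using uw(3) by (simp add: sum.reindex[OF inj])
    then have "0 = pairing (e p) (\<Sum>q\<in>F. u (\<xi> q) *s \<xi> q)"
      by simp
    also have "\<dots> = (\<Sum>q\<in>F. pairing (e p) (u (\<xi> q) *s \<xi> q))"
      using assms(1) by (induction F rule: finite_induct) (auto simp: pairing_add_right)
    also have "\<dots> = (\<Sum>q\<in>F. if q = p then u (\<xi> p) * pairing (\<xi> p) (e p) else 0)"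
      using assms(3) p(1)
      by (intro sum.cong) (auto simp: pairing_scale_right pairing_commute[of "e p"])
    also have "\<dots> = u w * pairing (\<xi> p) (e p)"
      using assms(1) p by simp
    finally show False using uw(2) assms(2)[OF p(1)] by simp
  qed
qed

section \<open>Irreducible sets and components\<close>

text \<open>
  A polynomial arc is irreducible because the polynomial ring in one variable is a domain.  Hence a
  set is irreducible as soon as polynomial arcs in it join any two of its points.
\<close>

lemma irreducible_set_if_arcs:
  fixes Z :: "('a::field_char_0 ^ 'n) set"
  assumes "Z \<noteq> {}"
    "\<And>x y. x \<in> Z \<Longrightarrow> y \<in> Z \<Longrightarrow> \<exists>G s r. (\<forall>t. arc G t \<in> Z) \<and> arc G s = x \<and> arc G r = y"
  shows "irreducible_set Z"
  unfolding irreducible_set_def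
proof (intro conjI allI impI)
  fix A B :: "('a ^ 'n) set"
  assume A: "closedin zariski A" and B: "closedin zariski B" and AB: "Z \<subseteq> A \<union> B"
  show "Z \<subseteq> A \<or> Z \<subseteq> B"
  proof (rule ccontr)
    assume "\<not> (Z \<subseteq> A \<or> Z \<subseteq> B)"
    then obtain x y where xy: "x \<in> Z" "x \<notin> A" "y \<in> Z" "y \<notin> B" by blast
    obtain p where p: "p \<in> vpolys" "p x \<noteq> 0" "\<And>z. z \<in> A \<Longrightarrow> p z = 0"
      using closedin_separating_poly[OF A xy(2)] by metis
    obtain q where q: "q \<in> vpolys" "q y \<noteq> 0" "\<And>z. z \<in> B \<Longrightarrow> q z = 0"
      using closedin_separating_poly[OF B xy(4)] by metis
    obtain G s r where G: "\<And>t. arc G t \<in> Z" "arc G s = x" "arc G r = y"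
      using assms(2)[OF xy(1,3)] by auto
    have coords: "\<exists>q. \<forall>t. c (arc G t) = poly q t" if "c \<in> vec_coords" for c
      using that by (auto simp: vec_coords_def)
    obtain p' where p': "\<And>t. p (arc G t) = poly p' t"
      using polyfun_comp_poly[OF p(1), of "arc G"] coords by auto
    obtain q' where q': "\<And>t. q (arc G t) = poly q' t"
      using polyfun_comp_poly[OF q(1), of "arc G"] coords by auto
    have "poly (p' * q') t = poly 0 t" for t
      using G(1)[of t] AB p(3)[of "arc G t"] q(3)[of "arc G t"] by (auto simp: p' q')
    then have "p' * q' = 0"
      by (simp flip: poly_eq_poly_eq_iff add: fun_eq_iff)
    then show False using p(2) q(2) p'[of s] q'[of r] G(2,3) by auto
  qed
qed (rule assms(1))

text \<open>
  An irreducible set is not the union of the two closed sets \<open>B\<close> and the closure of \<open>Z - B\<close> unless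
  one of them is everything.
\<close>

lemma closure_of_diff_closed:
  fixes Z :: "('a::field ^ 'n) set"
  assumes "irreducible_set Z" "closedin zariski Z" "closedin zariski B" "\<not> Z \<subseteq> B"
  shows "zariski closure_of (Z - B) = Z"
proof
  show "zariski closure_of (Z - B) \<subseteq> Z"
    by (rule closure_of_minimal) (use assms(2) in auto)
  have "Z - B \<subseteq> zariski closure_of (Z - B)" by (rule closure_of_subset) simp
  then have "Z \<subseteq> B \<union> zariski closure_of (Z - B)" by blast
  then show "Z \<subseteq> zariski closure_of (Z - B)"
    using assms unfolding irreducible_set_def by (meson closedin_closure_of)
qed

lemma components_of_diff_closed:
  fixes Z :: "('a::field ^ 'n) set"
  assumes "irreducible_set Z" "closedin zariski Z" "closedin zariski B" "\<not> Z \<subseteq> B"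
  shows "components_of_constructible (Z - B) = {Z - B}"
proof -
  have "closed_components Z = {Z}"
    using assms(1) by (auto simp: closed_components_def)
  then show ?thesis
    by (auto simp: components_of_constructible_def closure_of_diff_closed[OF assms])
qed

text \<open>
  Two members of a chain that refute the inclusions in \<open>A\<close> and in \<open>B\<close> are comparable, and the larger one
  refutes both.  Zorn's lemma then provides a component through every point.
\<close>

lemma irreducible_set_chain_Union:
  assumes "subset.chain {C. irreducible_set C} \<C>" "\<C> \<noteq> {}"
  shows "irreducible_set (\<Union>\<C>)"
  unfolding irreducible_set_def
proof (intro conjI allI impI)
  have irred: "irreducible_set C" if "C \<in> \<C>" for C
    using that assms(1) by (auto simp: subset_chain_def)
  show "\<Union>\<C> \<noteq> {}"
    using assms(2) irred unfolding irreducible_set_def by fastforce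
  fix A B :: "('a ^ 'b) set"
  assume AB: "closedin zariski A" "closedin zariski B" "\<Union>\<C> \<subseteq> A \<union> B"
  show "\<Union>\<C> \<subseteq> A \<or> \<Union>\<C> \<subseteq> B"
  proof (rule ccontr)
    assume "\<not> ?thesis"
    then obtain C1 C2 where C: "C1 \<in> \<C>" "\<not> C1 \<subseteq> A" "C2 \<in> \<C>" "\<not> C2 \<subseteq> B" by blast
    then have "C1 \<subseteq> C2 \<or> C2 \<subseteq> C1"
      using assms(1) by (auto simp: subset_chain_def)
    then obtain C where "C \<in> \<C>" "\<not> C \<subseteq> A" "\<not> C \<subseteq> B" using C by blast
    moreover have "C \<subseteq> A \<union> B" using \<open>C \<in> \<C>\<close> AB(3) by blast
    ultimately show False using irred AB(1,2) unfolding irreducible_set_def by blast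
  qed
qed

lemma irreducible_set_singleton: "irreducible_set {x}"
  by (auto simp: irreducible_set_def)

lemma point_in_component:
  fixes S :: "('a::field ^ 'n) set"
  assumes "x \<in> S"
  obtains C where "C \<in> components_of_constructible S" "x \<in> C"
proof -
  let ?Z = "zariski closure_of S"
  let ?A = "{C. irreducible_set C \<and> x \<in> C \<and> C \<subseteq> ?Z}"
  have "x \<in> ?Z" using closure_of_subset[of S zariski] assms by auto
  then have "{x} \<in> ?A" using irreducible_set_singleton by auto
  then have "?A \<noteq> {}" by blast
  moreover have "\<Union>\<C> \<in> ?A" if "\<C> \<noteq> {}" "subset.chain ?A \<C>" for \<C>
  proof -
    have "subset.chain {C. irreducible_set C} \<C>"
      using that(2) by (auto simp: subset_chain_def)
    then have "irreducible_set (\<Union>\<C>)" using that(1) by (rule irreducible_set_chain_Union)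
    then show ?thesis using that by (auto simp: subset_chain_def)
  qed
  ultimately obtain Z where Z: "Z \<in> ?A" "\<forall>X\<in>?A. Z \<subseteq> X \<longrightarrow> X = Z"
    using subset_Zorn_nonempty[of ?A] by auto
  have "Z \<in> closed_components ?Z"
    unfolding closed_components_def using Z by blast
  then show ?thesis
    using that[of "S \<inter> Z"] Z(1) assms by (auto simp: components_of_constructible_def)
qed

lemma open_dense_in_both_closures_eq:
  assumes "open_dense_in (C \<inter> C') C" "open_dense_in (C \<inter> C') C'"
  shows "zariski closure_of C = zariski closure_of C'"
proof -
  have "zariski closure_of C \<subseteq> zariski closure_of C'" if "open_dense_in (C \<inter> C') C"
    for C C' :: "('a ^ 'b) set"
  proof -
    have "C \<subseteq> zariski closure_of (C \<inter> C')" using that by (simp add: open_dense_in_def)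
    also have "\<dots> \<subseteq> zariski closure_of C'" by (rule closure_of_mono) simp
    finally show ?thesis by (rule closure_of_minimal) simp
  qed
  then show ?thesis using assms by (metis Int_commute subset_antisym)
qed

lemma open_in_closure_diff:
  assumes "closedin zariski Z" "closedin zariski B"
  shows "open_in_closure (Z - B)"
proof -
  have "zariski closure_of (Z - B) \<subseteq> Z" by (rule closure_of_minimal) (use assms(1) in auto)
  moreover have "Z - B \<subseteq> zariski closure_of (Z - B)" by (rule closure_of_subset) simp
  ultimately have "Z - B = (- B) \<inter> zariski closure_of (Z - B)" by blast
  then show ?thesis
    unfolding open_in_closure_def openin_subtopology using openin_Compl[OF assms(2)] by blast
qed

lemma open_in_closure_eq_diff:
  assumes "open_in_closure S"
  obtains B where "closedin zariski B" "S = zariski closure_of S - B"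
proof -
  obtain U where U: "openin zariski U" "S = U \<inter> zariski closure_of S"
    using assms unfolding open_in_closure_def openin_subtopology by blast
  show ?thesis using that[of "- U"] closedin_Compl[OF U(1)] U(2) by blast
qed

lemma constructible_diff:
  assumes "closedin zariski Z" "closedin zariski B"
  shows "constructible (Z - B)"
proof -
  have "Z - B = - (- Z \<union> B)" by blast
  then show ?thesis using assms by (metis constructible.intros)
qed


section \<open>Limits of pairs of a point and a subspace\<close>

text \<open>
  The two limit notions are used through two properties: a limit satisfies every polynomial equation
  that holds along the set, and a subspace that is constant along a punctured line survives at the
  missing point.
\<close>

locale algebraic_limit =
  fixes L :: "('a::field_char_0, 'n::finite) limit_notion"
  assumes zariski_limit: "L A a W \<Longrightarrow> zariski_limit A a W"
    and constant_on_line: "\<lbrakk>openin zariski U; 0 \<in> U;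
      \<And>t. t \<noteq> 0 \<Longrightarrow> t *s v \<in> U \<Longrightarrow> (t *s v, row_space N) \<in> A\<rbrakk> \<Longrightarrow> L A 0 (row_space N)"

lemma poly_on_line:
  fixes p :: "'a::field_char_0 ^ 'n \<Rightarrow> 'a"
  assumes "p \<in> vpolys"
  obtains q where "\<And>t. p (t *s v) = poly q t"
proof -
  have "\<exists>q. \<forall>t. c (t *s v) = poly q t" if "c \<in> vec_coords" for c
  proof -
    obtain i where "c = (\<lambda>x. x $ i)" using \<open>c \<in> vec_coords\<close> by (auto simp: vec_coords_def)
    then show ?thesis by (intro exI[of _ "[:0, v $ i:]"]) simp
  qed
  then show ?thesis using that polyfun_comp_poly[OF assms, of "\<lambda>t. t *s v"] by auto
qed

text \<open>
  Restricted to the line, every polynomial in the point and the matrix is a polynomial in the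
  parameter.  It vanishes identically if it vanishes at all but finitely many parameters.
\<close>

lemma zariski_limit_algebraic: "algebraic_limit zariski_limit"
proof
  fix U :: "('a::field_char_0 ^ 'n) set" and v N and A :: "(('a ^ 'n) \<times> ('a ^ 'n) set) set"
  assume U: "openin zariski U" "0 \<in> U"
    and A: "\<And>t. t \<noteq> 0 \<Longrightarrow> t *s v \<in> U \<Longrightarrow> (t *s v, row_space N) \<in> A"
  let ?B = "{(x, M). (x, row_space M) \<in> A \<and> vec.dim (row_space M) = vec.dim (row_space N)}"
  obtain p where p: "p \<in> vpolys" "p 0 \<noteq> 0" "\<And>y. p y \<noteq> 0 \<Longrightarrow> y \<in> U"
    using openin_nonvanishing_nhd[OF U] by metis
  obtain p' where p': "\<And>t. p (t *s v) = poly p' t" using poly_on_line[OF p(1)] by metis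
  have "(0, N) \<in> zariski_on vec_mat_coords closure_of ?B"
    unfolding in_zariski_closure_iff
  proof (intro ballI impI, rule ccontr)
    fix h :: "('a ^ 'n) \<times> ('a ^ 'n ^ 'n) \<Rightarrow> 'a"
    assume h: "h \<in> polyfuns vec_mat_coords" "\<forall>b\<in>?B. h b = 0" "h (0, N) \<noteq> 0"
    have "\<exists>q. \<forall>t. c (t *s v, N) = poly q t" if c: "c \<in> vec_mat_coords" for c
    proof -
      consider i where "c = (\<lambda>(x, M). x $ i)" | i j where "c = (\<lambda>(x, M). M $ i $ j)"
        using c unfolding vec_mat_coords_def by auto
      then show ?thesis
      proof cases
        case 1
        then show ?thesis by (intro exI[of _ "[:0, v $ i:]"]) simp
      next
        case 2
        then show ?thesis by (intro exI[of _ "[:N $ i $ j:]"]) simp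
      qed
    qed
    then obtain h' where h': "\<And>t. h (t *s v, N) = poly h' t"
      using polyfun_comp_poly[OF h(1), of "\<lambda>t. (t *s v, N)"] by auto
    have nz: "p' \<noteq> 0" "h' \<noteq> 0"
      using p'[of 0] h'[of 0] p(2) h(3) by auto
    \<comment> \<open>The factors \<open>t\<close> and \<open>p'\<close> absorb the parameters at which \<open>h'\<close> is not known to vanish.\<close>
    have "poly ([:0, 1:] * p' * h') t = 0" for t
    proof (cases "t = 0 \<or> p (t *s v) = 0")
      case False
      then have "h (t *s v, N) = 0" using A[of t] p(3) h(2) by auto
      then show ?thesis using h' by simp
    qed (auto simp: p')
    then have "[:0, 1:] * p' * h' = 0"
      by (simp flip: poly_eq_poly_eq_iff add: fun_eq_iff)
    then show False using nz by simp
  qed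
  then show "zariski_limit A 0 (row_space N)"
    unfolding zariski_limit_def by blast
qed

lemma polyfuns_tendsto:
  fixes f :: "nat \<Rightarrow> 'b" and p :: "'b \<Rightarrow> 'a::real_normed_field"
  assumes "p \<in> polyfuns C" "\<And>c. c \<in> C \<Longrightarrow> (\<lambda>m. c (f m)) \<longlonglongrightarrow> c b"
  shows "(\<lambda>m. p (f m)) \<longlonglongrightarrow> p b"
  using assms(1) by induction (auto intro: tendsto_intros assms(2))

text \<open>
  Polynomials are continuous for the Euclidean topology, so a limit of sequences is a limit in the
  Zariski sense as well.
\<close>

lemma euclidean_limit_algebraic:
  "algebraic_limit (euclidean_limit :: ('a::real_normed_field, 'n::finite) limit_notion)"
proof
  fix A :: "(('a ^ 'n) \<times> ('a ^ 'n) set) set" and a W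
  assume "euclidean_limit A a W"
  then obtain x V M N where A: "\<And>m. (x m, V m) \<in> A" and x: "x \<longlonglongrightarrow> a"
    and dim: "\<forall>\<^sub>F m in sequentially. vec.dim (V m) = vec.dim W"
    and M: "\<And>m. V m = row_space (M m)" "W = row_space N" "M \<longlonglongrightarrow> N"
    unfolding euclidean_limit_def subspace_tendsto_def by blast
  let ?B = "{(x, M). (x, row_space M) \<in> A \<and> vec.dim (row_space M) = vec.dim W}"
  have "(a, N) \<in> zariski_on vec_mat_coords closure_of ?B"
    unfolding in_zariski_closure_iff
  proof (intro ballI impI)
    fix h :: "('a ^ 'n) \<times> ('a ^ 'n ^ 'n) \<Rightarrow> 'a"
    assume h: "h \<in> polyfuns vec_mat_coords" "\<forall>b\<in>?B. h b = 0"
    have "(\<lambda>m. h (x m, M m)) \<longlonglongrightarrow> h (a, N)"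
    proof (rule polyfuns_tendsto[OF h(1)])
      fix c :: "('a ^ 'n) \<times> ('a ^ 'n ^ 'n) \<Rightarrow> 'a"
      assume "c \<in> vec_mat_coords"
      then show "(\<lambda>m. c (x m, M m)) \<longlonglongrightarrow> c (a, N)"
        unfolding vec_mat_coords_def using x M(3) by (auto intro: tendsto_vec_nth)
    qed
    moreover have ev: "\<forall>\<^sub>F m in sequentially. h (x m, M m) = 0"
      using dim
    proof eventually_elim
      case (elim m)
      then have "(x m, M m) \<in> ?B" using A[of m] by (simp add: M(1))
      then show ?case using h(2) by blast
    qed
    ultimately show "h (a, N) = 0"
      using LIMSEQ_unique[OF _ tendsto_eventually[OF ev]] by simp
  qed
  then show "zariski_limit A a W"
    unfolding zariski_limit_def using M(2) by blast
next
  fix U :: "('a ^ 'n) set" and v N and A :: "(('a ^ 'n) \<times> ('a ^ 'n) set) set"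
  assume U: "openin zariski U" "0 \<in> U"
    and A: "\<And>t. t \<noteq> 0 \<Longrightarrow> t *s v \<in> U \<Longrightarrow> (t *s v, row_space N) \<in> A"
  obtain p where p: "p \<in> vpolys" "p 0 \<noteq> 0" "\<And>y. p y \<noteq> 0 \<Longrightarrow> y \<in> U"
    using openin_nonvanishing_nhd[OF U] by metis
  define x where "x = (\<lambda>m. inverse (of_nat (Suc m) :: 'a) *s v)"
  have lim: "x \<longlonglongrightarrow> 0"
  proof (rule vec_tendstoI)
    fix i
    have "(\<lambda>m. inverse (of_nat (Suc m) :: 'a) * v $ i) \<longlonglongrightarrow> 0 * v $ i"
      using LIMSEQ_Suc[OF lim_inverse_n[where 'a = 'a]] by (intro tendsto_mult tendsto_const) simp
    then show "(\<lambda>m. x m $ i) \<longlonglongrightarrow> 0 $ i" by (simp add: x_def)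
  qed
  have "(\<lambda>m. p (x m)) \<longlonglongrightarrow> p 0"
  proof (rule polyfuns_tendsto[OF p(1)])
    fix c :: "'a ^ 'n \<Rightarrow> 'a" assume "c \<in> vec_coords"
    then show "(\<lambda>m. c (x m)) \<longlonglongrightarrow> c 0"
      unfolding vec_coords_def using tendsto_vec_nth[OF lim] by auto
  qed
  then have "\<forall>\<^sub>F m in sequentially. p (x m) \<noteq> 0"
    by (rule tendsto_imp_eventually_ne) (rule p(2))
  then obtain k where k: "\<And>m. m \<ge> k \<Longrightarrow> p (x m) \<noteq> 0"
    unfolding eventually_sequentially by blast
  have "(x (m + k), row_space N) \<in> A" for m
    using A[of "inverse (of_nat (Suc (m + k)))"] p(3)[OF k[of "m + k"]]
    by (simp add: x_def del: of_nat_Suc)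
  moreover have "(\<lambda>m. x (m + k)) \<longlonglongrightarrow> 0" using lim by (rule LIMSEQ_ignore_initial_segment)
  moreover have "subspace_tendsto (\<lambda>m. row_space N) (row_space N)"
    unfolding subspace_tendsto_def by (intro conjI exI[of _ "\<lambda>_. N"] exI[of _ N]) auto
  ultimately show "euclidean_limit A 0 (row_space N)"
    unfolding euclidean_limit_def
    by (intro exI[of _ "\<lambda>m. x (m + k)"] exI[of _ "\<lambda>m. row_space N"]) auto
qed

lemma zariski_limit_relations:
  assumes "zariski_limit A a W"
  obtains N where "W = row_space N"
    "\<forall>h\<in>polyfuns vec_mat_coords. (\<forall>x M. (x, row_space M) \<in> A \<longrightarrow> h (x, M) = 0) \<longrightarrow> h (a, N) = 0"
proof -
  let ?B = "{(x, M). (x, row_space M) \<in> A \<and> vec.dim (row_space M) = vec.dim W}"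
  obtain N where N: "W = row_space N" "(a, N) \<in> zariski_on vec_mat_coords closure_of ?B"
    using assms unfolding zariski_limit_def by blast
  have "h (a, N) = 0" if "h \<in> polyfuns vec_mat_coords"
    "\<forall>x M. (x, row_space M) \<in> A \<longrightarrow> h (x, M) = 0" for h
    using N(2) that unfolding in_zariski_closure_iff by blast
  then show ?thesis using that N(1) by blast
qed

text \<open>
  The matrices that define the limit have the same rank as the limit, and the closure of the empty
  set is empty.
\<close>

lemma zariski_limit_dim:
  assumes "zariski_limit A a W"
  obtains x V where "(x, V) \<in> A" "vec.dim V = vec.dim W"
proof -
  let ?B = "{(x, M). (x, row_space M) \<in> A \<and> vec.dim (row_space M) = vec.dim W}"
  obtain N where N: "(a, N) \<in> zariski_on vec_mat_coords closure_of ?B"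
    using assms unfolding zariski_limit_def by blast
  have "?B \<noteq> {}"
  proof
    assume "?B = {}"
    with N show False by (simp only: closure_of_empty empty_iff)
  qed
  then show ?thesis using that by blast
qed

lemma row_in_row_space: "M $ i \<in> row_space M"
  unfolding row_space_def by (rule vec.span_base) (auto simp: rows_def row_def)

lemma subspace_row_space: "vec.subspace (row_space M)"
  by (simp add: row_space_def)

lemma row_space_subsetI:
  assumes "vec.subspace T" "\<And>i. M $ i \<in> T"
  shows "row_space M \<subseteq> T"
  unfolding row_space_def using assms by (intro vec.span_minimal) (auto simp: rows_def row_def)

lemma zariski_limit_subspace: "zariski_limit A a W \<Longrightarrow> vec.subspace W"
  unfolding zariski_limit_def by (auto simp: subspace_row_space)

lemma zariski_limit_point:
  assumes "zariski_limit A a W" "p \<in> vpolys" "\<And>x V. (x, V) \<in> A \<Longrightarrow> p x = 0"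
  shows "p a = 0"
proof -
  obtain N where
    "\<forall>h\<in>polyfuns vec_mat_coords. (\<forall>x M. (x, row_space M) \<in> A \<longrightarrow> h (x, M) = 0) \<longrightarrow> h (a, N) = 0"
    using zariski_limit_relations[OF assms(1)] by blast
  from this[rule_format, OF vec_mat_polys_fst[OF assms(2)]] assms(3) show ?thesis by simp
qed

lemma zariski_limit_point_in_closed:
  assumes "zariski_limit A a W" "closedin zariski Z" "\<And>x V. (x, V) \<in> A \<Longrightarrow> x \<in> Z"
  shows "a \<in> Z"
proof (rule ccontr)
  assume "a \<notin> Z"
  then obtain p where "p \<in> vpolys" "p a \<noteq> 0" "\<And>y. y \<in> Z \<Longrightarrow> p y = 0"
    using closedin_separating_poly[OF assms(2)] by metis
  then show False using zariski_limit_point[OF assms(1)] assms(3) by metis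
qed

text \<open>
  The pairing of a polynomial covector field with a row of the matrix is a polynomial in the point and
  the matrix entries, so its vanishing persists in the limit.
\<close>

lemma zariski_limit_covector:
  fixes \<xi> :: "'a::field ^ 'n \<Rightarrow> 'a ^ 'n"
  assumes "zariski_limit A a W" "\<And>i. (\<lambda>x. \<xi> x $ i) \<in> vpolys"
    "\<And>x V v. (x, V) \<in> A \<Longrightarrow> v \<in> V \<Longrightarrow> pairing (\<xi> x) v = 0" "w \<in> W"
  shows "pairing (\<xi> a) w = 0"
proof -
  obtain N where N: "W = row_space N"
    "\<forall>h\<in>polyfuns vec_mat_coords. (\<forall>x M. (x, row_space M) \<in> A \<longrightarrow> h (x, M) = 0) \<longrightarrow> h (a, N) = 0"
    using zariski_limit_relations[OF assms(1)] .
  have "pairing (\<xi> a) (N $ i) = 0" for i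
  proof -
    have "(\<lambda>z. pairing (\<xi> (fst z)) (snd z $ i)) \<in> polyfuns vec_mat_coords"
      unfolding pairing_def
      by (intro polyfuns_sum polyfuns.mult vec_mat_polys_fst assms(2) vec_mat_polys_entry) simp
    moreover have "pairing (\<xi> x) (M $ i) = 0" if "(x, row_space M) \<in> A" for x M
      using assms(3)[OF that row_in_row_space] .
    ultimately show ?thesis using N(2) by fastforce
  qed
  then have "row_space N \<subseteq> {v. pairing (\<xi> a) v = 0}"
    by (intro row_space_subsetI subspace_pairing) auto
  then show ?thesis using N(1) assms(4) by blast
qed


section \<open>Smooth strata\<close>

lemma closedin_common_zeros:
  fixes F :: "('b \<Rightarrow> 'a::field) set"
  assumes "F \<subseteq> polyfuns C"
  shows "closedin (zariski_on C) {x. \<forall>p\<in>F. p x = 0}"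
proof -
  have "zariski_on C closure_of {x. \<forall>p\<in>F. p x = 0} \<subseteq> {x. \<forall>p\<in>F. p x = 0}"
    using assms unfolding subset_iff in_zariski_closure_iff by blast
  then show ?thesis by (simp flip: closure_of_subset_eq)
qed

lemma nonsingular_pointI:
  fixes F :: "('a::field_char_0 ^ 'n \<Rightarrow> 'a) set"
  assumes "closedin zariski B" "x \<in> S" "S = {y. \<forall>p\<in>F. p y = 0} - B" "finite F" "F \<subseteq> vpolys"
    "\<And>p. p \<in> F \<Longrightarrow> pairing (differential p x) (e p) \<noteq> 0"
    "\<And>p q. p \<in> F \<Longrightarrow> q \<in> F \<Longrightarrow> p \<noteq> q \<Longrightarrow> pairing (differential q x) (e p) = 0"
  shows "nonsingular_point S x"
  unfolding nonsingular_point_def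
proof (intro conjI exI)
  show "openin zariski (- B)" by (rule openin_Compl[OF assms(1)])
  show "x \<in> - B" using assms(2,3) by auto
  show "S \<inter> - B = {y \<in> - B. \<forall>p\<in>F. p y = 0}" using assms(3) by blast
  show "inj_on (\<lambda>p. differential p x) F" "vec.independent ((\<lambda>p. differential p x) ` F)"
    using independent_if_dual_vectors[of F "\<lambda>p. differential p x" e] assms(4,6,7) by auto
qed (use assms in auto)

text \<open>
  At a nonsingular point the value of a Gauss extension is prescribed.  On a smooth set the tangent
  spaces are therefore the only candidate, and only the closedness of their graph is at stake.
\<close>

lemma gauss_regular_if_smooth:
  assumes "open_in_closure S" "\<And>x. x \<in> S \<Longrightarrow> nonsingular_point S x"
    "\<And>a W. a \<in> S \<Longrightarrow> L {(x, tangent_space S x) |x. x \<in> S} a W \<Longrightarrow> W = tangent_space S a"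
  shows "G_regular L S" "x \<in> S \<Longrightarrow> gauss_tangent L S x = tangent_space S x"
proof -
  let ?T = "\<lambda>x\<in>S. tangent_space S x"
  have graph: "{(x, ?T x) |x. x \<in> S} = {(x, tangent_space S x) |x. x \<in> S}" by auto
  have ext: "gauss_extension L S ?T"
    unfolding gauss_extension_def graph using assms(3)
    by (auto simp: subspace_tangent_space nonsingular_point_def)
  have unique: "T = ?T" if "gauss_extension L S T" for T
  proof (rule extensionalityI)
    show "T \<in> extensional S" using that by (simp add: gauss_extension_def)
    fix x assume "x \<in> S"
    then show "T x = ?T x" using that assms(2) by (simp add: gauss_extension_def)
  qed simp
  show "G_regular L S" unfolding G_regular_def using assms(1) ext unique by blast
  have "gauss_tangent L S = ?T" unfolding gauss_tangent_def using ext unique by (rule the_equality)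
  then show "x \<in> S \<Longrightarrow> gauss_tangent L S x = tangent_space S x" by simp
qed

lemma gauss_tangent_nonsingular:
  assumes "G_regular L S" "nonsingular_point S x"
  shows "gauss_tangent L S x = tangent_space S x"
proof -
  have "gauss_extension L S (gauss_tangent L S)"
    using assms(1) theI'[of "gauss_extension L S"] unfolding G_regular_def gauss_tangent_def by simp
  then show ?thesis using assms(2) by (simp add: gauss_extension_def)
qed

lemma (in algebraic_limit) TWG_stratification_if_smooth:
  assumes "finite P" "partition_on (Sing f) P"
    and P: "\<And>S. S \<in> P \<Longrightarrow> constructible S" "\<And>S. S \<in> P \<Longrightarrow> open_in_closure S"
      "\<And>S x. S \<in> P \<Longrightarrow> x \<in> S \<Longrightarrow> nonsingular_point S x"
    and gauss: "\<And>S a W. \<lbrakk>S \<in> P; a \<in> S; zariski_limit {(x, tangent_space S x) |x. x \<in> S} a W\<rbrakk>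
      \<Longrightarrow> W = tangent_space S a"
    and thom: "\<And>S a V. \<lbrakk>S \<in> P; a \<in> S;
        zariski_limit {(x, vec.span {differential f x}) |x. differential f x \<noteq> 0} a V\<rbrakk>
      \<Longrightarrow> annihilates V (tangent_space S a)"
    and whitney: "\<And>S S' a W. \<lbrakk>S \<in> P; S' \<in> P; S \<noteq> S'; a \<in> S';
        zariski_limit {(x, tangent_space S x) |x. x \<in> S} a W\<rbrakk> \<Longrightarrow> tangent_space S' a \<subseteq> W"
  shows "TWG_stratification L f P"
proof -
  have regular: "G_regular L S" and
    tangent: "\<And>x. x \<in> S \<Longrightarrow> gauss_tangent L S x = tangent_space S x" if "S \<in> P" for S
    by (rule gauss_regular_if_smooth[OF P(2,3)[OF that] gauss[OF that _ zariski_limit]]; assumption)+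
  have "{(x, gauss_tangent L S x) |x. x \<in> S} = {(x, tangent_space S x) |x. x \<in> S}" if "S \<in> P" for S
    using tangent[OF that] by auto
  note graph = this
  have "whitney_a L S S'" if "S \<in> P" "S' \<in> P" for S S'
    unfolding whitney_a_def graph[OF that(1)]
  proof (intro ballI allI impI)
    fix a W assume a: "a \<in> S'" and "L {(x, tangent_space S x) |x. x \<in> S} a W"
    then have "zariski_limit {(x, tangent_space S x) |x. x \<in> S} a W" by (intro zariski_limit)
    then have "tangent_space S' a \<subseteq> W"
      using gauss[OF that(1)] whitney[OF that] a by (cases "S = S'") auto
    then show "gauss_tangent L S' a \<subseteq> W" by (simp add: tangent[OF that(2) a])
  qed
  moreover have "thom_condition L f S" if "S \<in> P" for S
    unfolding thom_condition_def using tangent[OF that] thom[OF that] zariski_limit by simp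
  ultimately show ?thesis
    unfolding TWG_stratification_def using assms(1,2) P regular by blast
qed

lemma tangent_spaceD:
  assumes "v \<in> tangent_space S x" "p \<in> vpolys" "\<And>y. y \<in> S \<Longrightarrow> p y = 0"
  shows "pairing (differential p x) v = 0"
  using assms by (simp add: tangent_space_def)

definition coord_subspace :: "'n set \<Rightarrow> ('a::field ^ 'n) set" where
  "coord_subspace I = {v. \<forall>i. i \<notin> I \<longrightarrow> v $ i = 0}"

lemma coord_subspace_eq_zeros:
  "coord_subspace I = {y. \<forall>p\<in>(\<lambda>i x. x $ i) ` (- I). p y = 0}"
  by (auto simp: coord_subspace_def)

lemma closedin_coord_subspace: "closedin zariski (coord_subspace I)"
  unfolding coord_subspace_eq_zeros by (rule closedin_common_zeros) (auto intro: vpolys_coord)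

lemma subspace_coord_subspace: "vec.subspace (coord_subspace I)"
  by (auto simp: coord_subspace_def vec.subspace_def)

lemma zero_in_coord_subspace: "0 \<in> coord_subspace I"
  by (simp add: coord_subspace_def)

lemma axis_in_coord_subspace: "i \<in> I \<Longrightarrow> axis i c \<in> coord_subspace I"
  by (auto simp: coord_subspace_def axis_def)

lemma coord_subspace_mono: "I \<subseteq> J \<Longrightarrow> coord_subspace I \<subseteq> coord_subspace J"
  by (auto simp: coord_subspace_def)

lemma coord_subspace_empty: "coord_subspace {} = {0}"
  by (auto simp: coord_subspace_def vec_eq_iff)

lemma irreducible_coord_subspace:
  "irreducible_set (coord_subspace I :: ('a::field_char_0 ^ 'n) set)"
proof (rule irreducible_set_if_arcs)
  show "coord_subspace I \<noteq> ({} :: ('a ^ 'n) set)" using zero_in_coord_subspace by blast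
  fix x y :: "'a ^ 'n" assume "x \<in> coord_subspace I" "y \<in> coord_subspace I"
  then show "\<exists>G s r. (\<forall>t. arc G t \<in> coord_subspace I) \<and> arc G s = x \<and> arc G r = y"
    by (intro exI[of _ "\<lambda>i. [:x $ i, y $ i - x $ i:]"] exI[of _ 0] exI[of _ 1])
      (auto simp: coord_subspace_def vec_eq_iff)
qed

text \<open>
  The coordinates outside \<open>I\<close> bound the tangent space from above and the straight lines in the
  subspace bound it from below.
\<close>

lemma coord_subspace_diff_smooth:
  fixes B :: "('a::field_char_0 ^ 'n) set"
  assumes "closedin zariski B" "x \<in> coord_subspace I - B"
  shows "nonsingular_point (coord_subspace I - B) x"
    "tangent_space (coord_subspace I - B) x = coord_subspace I"
proof -
  define F :: "('a ^ 'n \<Rightarrow> 'a) set" where "F = (\<lambda>i x. x $ i) ` (- I)"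
  have inj: "i = j" if "(\<lambda>x::'a ^ 'n. x $ i) = (\<lambda>x. x $ j)" for i j
    using fun_cong[OF that, of "axis i 1"] by (auto simp: axis_def split: if_splits)
  \<comment> \<open>The dual vectors are indexed by coordinate functions; injectivity recovers the index.\<close>
  define e :: "('a ^ 'n \<Rightarrow> 'a) \<Rightarrow> 'a ^ 'n" where "e p = axis (THE i. p = (\<lambda>x. x $ i)) 1" for p
  have e: "e (\<lambda>x. x $ i) = axis i 1" for i
  proof -
    have "(THE j. (\<lambda>x::'a ^ 'n. x $ i) = (\<lambda>x. x $ j)) = i" using inj by (intro the_equality) auto
    then show ?thesis by (simp add: e_def)
  qed
  show "nonsingular_point (coord_subspace I - B) x"
  proof (rule nonsingular_pointI[where F = F and e = e])
    show "coord_subspace I - B = {y. \<forall>p\<in>F. p y = 0} - B"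
      by (simp add: F_def coord_subspace_eq_zeros)
    show "F \<subseteq> vpolys" by (auto simp: F_def intro: vpolys_coord)
    show "pairing (differential p x) (e p) \<noteq> 0" if "p \<in> F" for p
      using that by (auto simp: F_def e differential_coord)
    show "pairing (differential q x) (e p) = 0" if "p \<in> F" "q \<in> F" "p \<noteq> q" for p q
      using that by (auto simp: F_def e differential_coord) (auto simp: axis_def)
  qed (use assms in \<open>auto simp: F_def\<close>)
  show "tangent_space (coord_subspace I - B) x = coord_subspace I"
  proof
    show "tangent_space (coord_subspace I - B) x \<subseteq> coord_subspace I"
    proof
      fix v assume v: "v \<in> tangent_space (coord_subspace I - B) x"
      have "v $ i = 0" if "i \<notin> I" for i
      proof -
        have "pairing (differential (\<lambda>x. x $ i) x) v = 0"
          using that by (intro tangent_spaceD[OF v vpolys_coord]) (auto simp: coord_subspace_def)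
        then show ?thesis by (simp add: differential_coord pairing_commute[of "axis i 1"])
      qed
      then show "v \<in> coord_subspace I" by (simp add: coord_subspace_def)
    qed
    have "\<not> coord_subspace I \<subseteq> B" using assms(2) by blast
    note closure = closure_of_diff_closed[OF irreducible_coord_subspace closedin_coord_subspace
        assms(1) this]
    show "coord_subspace I \<subseteq> tangent_space (coord_subspace I - B) x"
    proof
      fix v :: "'a ^ 'n" assume v: "v \<in> coord_subspace I"
      show "v \<in> tangent_space (coord_subspace I - B) x"
      proof (rule arc_velocity_in_tangent_space[OF _ _ arc_velocity_line])
        show "arc (\<lambda>i. [:x $ i, v $ i:]) t \<in> zariski closure_of (coord_subspace I - B)" for t
          unfolding closure arc_line using assms(2) v by (auto simp: coord_subspace_def)
      qed (simp add: arc_line)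
    qed
  qed
qed

lemma coord_subspace_eq_row_space:
  "coord_subspace I = row_space (\<chi> i. if i \<in> I then axis i 1 else (0::'a::field ^ 'n))"
  (is "_ = row_space ?N")
proof
  show "row_space ?N \<subseteq> coord_subspace I"
    by (rule row_space_subsetI[OF subspace_coord_subspace])
      (auto simp: axis_in_coord_subspace zero_in_coord_subspace)
  show "coord_subspace I \<subseteq> row_space ?N"
  proof
    fix v :: "'a ^ 'n" assume v: "v \<in> coord_subspace I"
    have "v $ j = (\<Sum>i\<in>UNIV. v $ i *s (?N $ i)) $ j" for j
    proof -
      have "(\<Sum>i\<in>UNIV. v $ i *s (?N $ i)) $ j = (\<Sum>i\<in>UNIV. if i = j then v $ j else 0)"
        unfolding sum_component using v
        by (intro sum.cong) (auto simp: coord_subspace_def axis_def)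
      then show ?thesis by simp
    qed
    then have "v = (\<Sum>i\<in>UNIV. v $ i *s (?N $ i))" by (rule iffD2[OF vec_eq_iff, OF allI])
    also have "\<dots> \<in> row_space ?N"
      by (intro vec.subspace_sum subspace_row_space vec.subspace_scale row_in_row_space)
    finally show "v \<in> row_space ?N" .
  qed
qed

text \<open>
  The coordinates that vanish on the family vanish on the limit, and the dimension does not drop.
\<close>

lemma zariski_limit_constant:
  assumes "zariski_limit {(x, coord_subspace I) |x. x \<in> S} a W"
  shows "W = coord_subspace I"
proof (rule vec.subspace_dim_equal)
  show "vec.subspace W" by (rule zariski_limit_subspace[OF assms])
  have "vec.dim W = vec.dim (coord_subspace I :: ('a ^ 'b) set)"
    by (rule zariski_limit_dim[OF assms]) simp
  then show "vec.dim (coord_subspace I :: ('a ^ 'b) set) \<le> vec.dim W" by simp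
  have "w $ i = 0" if "w \<in> W" "i \<notin> I" for w i
  proof -
    have "pairing (axis i 1) w = 0"
    proof (rule zariski_limit_covector[OF assms, where \<xi> = "\<lambda>_. axis i 1"])
      show "pairing (axis i 1) v = 0" if "(x, V) \<in> {(x, coord_subspace I) |x. x \<in> S}" "v \<in> V"
        for x V v
        using that \<open>i \<notin> I\<close> by (auto simp: coord_subspace_def pairing_commute[of "axis i 1"])
    qed (use that in \<open>auto intro: polyfuns.const\<close>)
    then show ?thesis by (simp add: pairing_commute[of "axis i 1"])
  qed
  then show "W \<subseteq> coord_subspace I" by (auto simp: coord_subspace_def)
qed (rule subspace_coord_subspace)


section \<open>The toric surface\<close>

lemma exhaust_5:
  fixes i :: 5
  obtains "i = 1" | "i = 2" | "i = 3" | "i = 4" | "i = 5"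
proof -
  have "i = 1 \<or> i = 2 \<or> i = 3 \<or> i = 4 \<or> i = 5"
  proof (induct i)
    case (of_int z)
    then have "z = 0 \<or> z = 1 \<or> z = 2 \<or> z = 3 \<or> z = 4" by simp presburger
    then show ?case by auto
  qed
  then show ?thesis using that by blast
qed

lemma forall_5: "(\<forall>i::5. P i) \<longleftrightarrow> P 1 \<and> P 2 \<and> P 3 \<and> P 4 \<and> P 5"
  by (metis exhaust_5)

lemma sum_5: "(\<Sum>i\<in>(UNIV :: 5 set). f i) = f 1 + f 2 + f 3 + f 4 + (f 5 :: 'a::comm_ring_1)"
proof -
  have "UNIV = {1::5, 2, 3, 4, 5}" using exhaust_5 by auto
  then show ?thesis unfolding \<open>UNIV = _\<close> by (simp add: ac_simps)
qed

definition vec5 :: "'a \<Rightarrow> 'a \<Rightarrow> 'a \<Rightarrow> 'a \<Rightarrow> 'a \<Rightarrow> 'a ^ 5" where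
  "vec5 x y u v w =
     (\<chi> i. if i = 1 then x else if i = 2 then y else if i = 3 then u else if i = 4 then v else w)"

lemma vec5_nth [simp]:
  "vec5 x y u v w $ 1 = x" "vec5 x y u v w $ 2 = y" "vec5 x y u v w $ 3 = u"
  "vec5 x y u v w $ 4 = v" "vec5 x y u v w $ 5 = w"
  by (simp_all add: vec5_def)

lemma vec_eq_5: "x = y \<longleftrightarrow> x $ 1 = y $ 1 \<and> x $ 2 = y $ 2 \<and> x $ 3 = y $ 3 \<and> x $ 4 = y $ 4 \<and>
    x $ 5 = y $ (5 :: 5)"
  by (simp add: vec_eq_iff forall_5)

lemma pairing_5: "pairing \<xi> v =
    \<xi> $ 1 * v $ 1 + \<xi> $ 2 * v $ 2 + \<xi> $ 3 * v $ 3 + \<xi> $ 4 * v $ 4 + \<xi> $ 5 * v $ (5 :: 5)"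
  by (simp add: pairing_def sum_5)

lemma vpolys_vec5:
  assumes "f1 \<in> vpolys" "f2 \<in> vpolys" "f3 \<in> vpolys" "f4 \<in> vpolys" "f5 \<in> vpolys"
  shows "(\<lambda>x. vec5 (f1 x) (f2 x) (f3 x) (f4 x) (f5 x) $ i) \<in> vpolys"
  by (cases i rule: exhaust_5) (simp_all add: assms)

lemma coord_subspace_345: "coord_subspace {3, 4, 5} = {p :: 'a::field ^ 5. p $ 1 = 0 \<and> p $ 2 = 0}"
  unfolding coord_subspace_def forall_5 by auto

lemma coord_subspace_5:
  "coord_subspace {5} = {p :: 'a::field ^ 5. p $ 1 = 0 \<and> p $ 2 = 0 \<and> p $ 3 = 0 \<and> p $ 4 = 0}"
  unfolding coord_subspace_def forall_5 by auto

definition toric_surface :: "('a::field ^ 5) set" where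
  "toric_surface = {p. p $ 1 = 0 \<and> p $ 2 = 0 \<and> p $ 3 * p $ 4 = p $ 5 ^ 4}"

definition toric_equation :: "'a::field ^ 5 \<Rightarrow> 'a" where
  "toric_equation p = p $ 3 * p $ 4 - p $ 5 ^ 4"

definition conormal :: "'a::field ^ 5 \<Rightarrow> 'a ^ 5" where
  "conormal p = vec5 0 0 (p $ 4) (p $ 3) (- 4 * p $ 5 ^ 3)"

definition tangent_plane :: "'a::field ^ 5 \<Rightarrow> ('a ^ 5) set" where
  "tangent_plane p = coord_subspace {3, 4, 5} \<inter> {v. pairing (conormal p) v = 0}"

lemma in_tangent_plane_iff: "v \<in> tangent_plane p \<longleftrightarrow>
    v $ 1 = 0 \<and> v $ 2 = 0 \<and> p $ 4 * v $ 3 + p $ 3 * v $ 4 = 4 * p $ 5 ^ 3 * v $ 5"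
  by (auto simp: tangent_plane_def coord_subspace_345 conormal_def pairing_5)

lemma subspace_tangent_plane: "vec.subspace (tangent_plane p)"
  unfolding tangent_plane_def
  by (intro vec.subspace_inter subspace_coord_subspace subspace_pairing)

lemma toric_surface_eq_zeros: "toric_surface =
    {p. \<forall>f\<in>{\<lambda>p. p $ 1, \<lambda>p. p $ 2, toric_equation}. f p = (0::'a::field)}"
  by (auto simp: toric_surface_def toric_equation_def)

lemma vpolys_toric_equation: "toric_equation \<in> vpolys"
  unfolding toric_equation_def[abs_def] by (intro polyfuns_intros)

lemma closedin_toric_surface: "closedin zariski toric_surface"
  unfolding toric_surface_eq_zeros
  by (rule closedin_common_zeros) (auto intro: vpolys_coord vpolys_toric_equation)

lemma toric_surface_subset: "toric_surface \<subseteq> coord_subspace {3, 4, 5}"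
  by (auto simp: toric_surface_def coord_subspace_345)

lemma toric_surface_nonzeroD:
  assumes "p \<in> toric_surface" "p \<noteq> 0"
  shows "p $ 3 \<noteq> 0 \<or> p $ 4 \<noteq> 0"
proof (rule ccontr)
  assume "\<not> ?thesis"
  then have "p = 0" using assms(1) by (auto simp: toric_surface_def vec_eq_5)
  then show False using assms(2) by simp
qed

lemma differential_toric_equation:
  "differential toric_equation (p :: 'a::field_char_0 ^ 5) = conormal p"
proof (rule differential_eqI)
  let ?L = "\<lambda>k i. [:p $ k, axis i 1 $ k:]"
  fix i :: 5
  show "poly (?L 3 i * ?L 4 i - ?L 5 i ^ 4) t = toric_equation (p + t *s axis i 1)" for t
    by (simp add: toric_equation_def algebra_simps)
  show "poly (pderiv (?L 3 i * ?L 4 i - ?L 5 i ^ 4)) 0 = conormal p $ i"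
    by (cases i rule: exhaust_5)
      (simp_all add: conormal_def axis_def pderiv_diff pderiv_mult pderiv_power pderiv_pCons)
qed

text \<open>
  The map \<open>(l, s, t) \<mapsto> (l s\<^sup>4, l\<^sup>3 t\<^sup>4, l s t)\<close> is onto the surface over every field, because the free
  factors \<open>l\<close> make fourth roots unnecessary.  The images of lines give the arcs that
  show irreducibility and that realise the tangent vectors.
\<close>

definition toric_arc :: "'a::field_char_0 poly \<Rightarrow> 'a poly \<Rightarrow> 'a poly \<Rightarrow> 5 \<Rightarrow> 'a poly" where
  "toric_arc l s t i = (if i = 3 then l * s ^ 4 else if i = 4 then l ^ 3 * t ^ 4
     else if i = 5 then l * s * t else 0)"

lemma arc_toric_arc: "arc (toric_arc l s t) r =
    vec5 0 0 (poly l r * poly s r ^ 4) (poly l r ^ 3 * poly t r ^ 4) (poly l r * poly s r * poly t r)"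
  by (simp add: vec_eq_5 toric_arc_def)

lemma arc_toric_arc_in_surface: "arc (toric_arc l s t) r \<in> toric_surface"
  unfolding arc_toric_arc toric_surface_def by (simp add: algebra_simps eval_nat_numeral)

lemma toric_surface_param:
  assumes "p \<in> (toric_surface :: ('a::field_char_0 ^ 5) set)"
  obtains l s t where "p = vec5 0 0 (l * s ^ 4) (l ^ 3 * t ^ 4) (l * s * t)"
proof (cases "p $ 3 = 0")
  case False
  have "p $ 4 = p $ 3 ^ 3 * (p $ 5 / p $ 3) ^ 4"
    using assms False by (simp add: toric_surface_def field_simps eval_nat_numeral)
  then show ?thesis
    using that[of "p $ 3" 1 "p $ 5 / p $ 3"] assms False by (simp add: vec_eq_5 toric_surface_def)
next
  case True
  have "p $ 4 = inverse (p $ 4) ^ 3 * p $ 4 ^ 4"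
    by (cases "p $ 4 = 0") (simp_all add: field_simps eval_nat_numeral)
  then show ?thesis
    using that[of "inverse (p $ 4)" 0 "p $ 4"] assms True by (simp add: vec_eq_5 toric_surface_def)
qed

lemma irreducible_toric_surface: "irreducible_set (toric_surface :: ('a::field_char_0 ^ 5) set)"
proof (rule irreducible_set_if_arcs)
  show "toric_surface \<noteq> ({} :: ('a ^ 5) set)" using arc_toric_arc_in_surface by blast
  fix p q :: "'a ^ 5" assume "p \<in> toric_surface" "q \<in> toric_surface"
  then obtain l s t l' s' t' where
    "p = vec5 0 0 (l * s ^ 4) (l ^ 3 * t ^ 4) (l * s * t)"
    "q = vec5 0 0 (l' * s' ^ 4) (l' ^ 3 * t' ^ 4) (l' * s' * t')"
    by (metis toric_surface_param)
  then have "arc (toric_arc [:l, l' - l:] [:s, s' - s:] [:t, t' - t:]) 0 = p"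
    "arc (toric_arc [:l, l' - l:] [:s, s' - s:] [:t, t' - t:]) 1 = q"
    by (simp_all add: arc_toric_arc)
  then show "\<exists>G s r. (\<forall>t. arc G t \<in> toric_surface) \<and> arc G s = p \<and> arc G r = q"
    using arc_toric_arc_in_surface by blast
qed

text \<open>
  An arc with \<open>s = 1\<close> passes through every point with \<open>u \<noteq> 0\<close>.  Exchanging the third and the fourth
  coordinate maps the surface to itself, which covers the remaining points.
\<close>

lemma tangent_plane_arc:
  fixes p :: "'a::field_char_0 ^ 5"
  assumes "p \<in> toric_surface" "p \<noteq> 0" "v \<in> tangent_plane p"
  obtains G where "\<And>t. arc G t \<in> toric_surface" "arc G 0 = p" "arc_velocity G = v"
proof (cases "p $ 3 = 0")
  case False
  \<comment> \<open>The point has parameters \<open>(p $ 3, 1, t)\<close>.  The slope \<open>c\<close> of the last parameter is fixed by the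
    required fifth component of the velocity, and the fourth one is then determined.\<close>
  define t where "t = p $ 5 / p $ 3"
  define c where "c = (v $ 5 - t * v $ 3) / p $ 3"
  let ?G = "toric_arc [:p $ 3, v $ 3:] 1 [:t, c:]"
  have p5: "p $ 5 = p $ 3 * t" and c: "v $ 5 = t * v $ 3 + p $ 3 * c"
    using False by (simp_all add: t_def c_def)
  have "p $ 3 * p $ 4 = p $ 3 * (p $ 3 ^ 3 * t ^ 4)"
    using assms(1) by (simp add: toric_surface_def p5 eval_nat_numeral algebra_simps)
  then have p4: "p $ 4 = p $ 3 ^ 3 * t ^ 4" using False by simp
  have "p $ 3 * v $ 4 = p $ 3 * (4 * p $ 3 ^ 2 * t ^ 3 * v $ 5 - p $ 3 ^ 2 * t ^ 4 * v $ 3)"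
    using assms(3) by (simp add: in_tangent_plane_iff p4 p5 eval_nat_numeral algebra_simps)
  then have v4: "v $ 4 = 4 * p $ 3 ^ 2 * t ^ 3 * v $ 5 - p $ 3 ^ 2 * t ^ 4 * v $ 3"
    using False by (metis mult_left_cancel)
  have "arc ?G 0 = p"
    using assms(1) by (simp add: arc_toric_arc vec_eq_5 toric_surface_def p4 p5)
  moreover have "arc_velocity ?G = v"
  proof -
    have "v $ 1 = 0" "v $ 2 = 0" using assms(3) by (simp_all add: in_tangent_plane_iff)
    then show ?thesis
      by (simp add: vec_eq_5 toric_arc_def pderiv_mult pderiv_power pderiv_pCons v4 c)
        (simp add: eval_nat_numeral algebra_simps)
  qed
  ultimately show ?thesis using that arc_toric_arc_in_surface by blast
next
  case True
  then have p4: "p $ 4 \<noteq> 0" using toric_surface_nonzeroD[OF assms(1,2)] by simp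
  have p5: "p $ 5 = 0" using True assms(1) by (simp add: toric_surface_def)
  have v3: "v $ 3 = 0" using assms(3) True p4 p5 by (simp add: in_tangent_plane_iff)
  let ?H = "toric_arc [:p $ 4, v $ 4:] 1 [:0, v $ 5 / p $ 4:]"
  let ?G = "?H(3 := ?H 4, 4 := ?H 3)"
  have "arc ?G t \<in> toric_surface" for t
    using arc_toric_arc_in_surface[of "[:p $ 4, v $ 4:]" 1 "[:0, v $ 5 / p $ 4:]" t]
    by (simp add: toric_surface_def mult.commute)
  moreover have "arc ?G 0 = p"
    using assms(1) True p5 by (simp add: vec_eq_5 toric_surface_def toric_arc_def)
  moreover have "arc_velocity ?G = v"
    using assms(3) p4 v3
    by (simp add: vec_eq_5 in_tangent_plane_iff toric_arc_def pderiv_mult pderiv_power pderiv_pCons)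
  ultimately show ?thesis using that by blast
qed

lemma toric_surface_diff_smooth:
  fixes B :: "('a::field_char_0 ^ 5) set"
  assumes B: "closedin zariski B" and p: "p \<in> toric_surface - B" "p \<noteq> 0"
  shows "nonsingular_point (toric_surface - B) p" "tangent_space (toric_surface - B) p = tangent_plane p"
proof -
  let ?F = "{\<lambda>p. p $ 1, \<lambda>p. p $ 2, toric_equation} :: ('a ^ 5 \<Rightarrow> 'a) set"
  have ne: "(\<lambda>p::'a ^ 5. p $ 1) \<noteq> (\<lambda>p. p $ 2)" "(\<lambda>p::'a ^ 5. p $ 1) \<noteq> toric_equation"
    "(\<lambda>p::'a ^ 5. p $ 2) \<noteq> toric_equation"
    by (auto simp: toric_equation_def dest: fun_cong[of _ _ "vec5 1 0 0 0 0"]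
        fun_cong[of _ _ "vec5 0 1 0 0 0"])
  define e :: "('a ^ 5 \<Rightarrow> 'a) \<Rightarrow> 'a ^ 5" where
    "e f = axis (if f = (\<lambda>p. p $ 1) then 1 else if f = (\<lambda>p. p $ 2) then 2
                 else if p $ 4 \<noteq> 0 then 3 else 4) 1" for f
  show "nonsingular_point (toric_surface - B) p"
  proof (rule nonsingular_pointI[where F = ?F and e = e, OF B p(1)])
    show "toric_surface - B = {y. \<forall>f\<in>?F. f y = 0} - B" by (simp only: toric_surface_eq_zeros)
    show "?F \<subseteq> vpolys" by (auto intro: vpolys_coord vpolys_toric_equation)
    show "pairing (differential f p) (e f) \<noteq> 0" if "f \<in> ?F" for f
      using that ne toric_surface_nonzeroD[of p] p
      by (auto simp: e_def differential_coord differential_toric_equation conormal_def)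
    show "pairing (differential f' p) (e f) = 0" if "f \<in> ?F" "f' \<in> ?F" "f \<noteq> f'" for f f'
      using that ne
      by (auto simp: e_def differential_coord differential_toric_equation conormal_def)
        (auto simp: axis_def)
  qed simp
  show "tangent_space (toric_surface - B) p = tangent_plane p"
  proof
    show "tangent_space (toric_surface - B) p \<subseteq> tangent_plane p"
    proof
      fix v assume v: "v \<in> tangent_space (toric_surface - B) p"
      have "pairing (differential f p) v = 0" if "f \<in> ?F" for f
      proof (rule tangent_spaceD[OF v])
        show "f \<in> vpolys" using that by (auto intro: vpolys_coord vpolys_toric_equation)
        show "f y = 0" if "y \<in> toric_surface - B" for y
          using that \<open>f \<in> ?F\<close> by (auto simp: toric_surface_def toric_equation_def)
      qed
      note * = this
      show "v \<in> tangent_plane p"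
        using *[of "\<lambda>p. p $ 1"] *[of "\<lambda>p. p $ 2"] *[of toric_equation]
        by (simp add: differential_coord differential_toric_equation tangent_plane_def
            coord_subspace_345 pairing_commute[of "axis _ 1"])
    qed
    show "tangent_plane p \<subseteq> tangent_space (toric_surface - B) p"
    proof
      fix v assume "v \<in> tangent_plane p"
      then obtain G where G: "\<And>t. arc G t \<in> toric_surface" "arc G 0 = p" "arc_velocity G = v"
        using tangent_plane_arc p by blast
      have "\<not> toric_surface \<subseteq> B" using p(1) by blast
      then have "zariski closure_of (toric_surface - B) = toric_surface"
        by (rule closure_of_diff_closed[OF irreducible_toric_surface closedin_toric_surface B])
      then show "v \<in> tangent_space (toric_surface - B) p"
        using arc_velocity_in_tangent_space[of G "toric_surface - B"] G by simp
    qed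
  qed
qed

lemma dim_tangent_plane:
  fixes p :: "'a::field_char_0 ^ 5"
  assumes "p \<in> toric_surface" "p \<noteq> 0"
  shows "vec.dim (tangent_plane p) = 2"
proof -
  obtain b1 b2 i :: "'a ^ 5" where b: "b1 \<in> tangent_plane p" "b2 \<in> tangent_plane p"
      "pairing b1 i \<noteq> 0" "pairing b2 i = 0" "pairing b1 (axis 5 1) = 0" "pairing b2 (axis 5 1) \<noteq> 0"
    and span: "\<And>v. v \<in> tangent_plane p \<Longrightarrow> \<exists>c d. v = c *s b1 + d *s b2"
  proof (cases "p $ 3 = 0")
    case False
    show ?thesis
    proof (rule that[of "vec5 0 0 (p $ 3) (- p $ 4) 0" "vec5 0 0 0 (4 * p $ 5 ^ 3) (p $ 3)" "axis 3 1"])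
      fix v assume v: "v \<in> tangent_plane p"
      then have "v $ 4 = (4 * p $ 5 ^ 3 * v $ 5 - p $ 4 * v $ 3) / p $ 3"
        using False by (simp add: in_tangent_plane_iff field_simps)
      then show "\<exists>c d. v = c *s vec5 0 0 (p $ 3) (- p $ 4) 0 + d *s vec5 0 0 0 (4 * p $ 5 ^ 3) (p $ 3)"
        using v False
        by (intro exI[of _ "v $ 3 / p $ 3"] exI[of _ "v $ 5 / p $ 3"])
          (simp add: vec_eq_5 in_tangent_plane_iff field_simps)
    qed (use False in \<open>auto simp: in_tangent_plane_iff\<close>)
  next
    case True
    then have p4: "p $ 4 \<noteq> 0" and p5: "p $ 5 = 0"
      using toric_surface_nonzeroD[OF assms] assms(1) by (simp_all add: toric_surface_def)
    show ?thesis
    proof (rule that[of "axis 4 1" "axis 5 1" "axis 4 1"])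
      fix v assume v: "v \<in> tangent_plane p"
      then show "\<exists>c d. v = c *s axis 4 1 + d *s axis 5 1"
        using True p4 p5
        by (intro exI[of _ "v $ 4"] exI[of _ "v $ 5"]) (simp add: vec_eq_5 in_tangent_plane_iff axis_def)
    qed (use True p5 in \<open>auto simp: in_tangent_plane_iff axis_def pairing_5\<close>)
  qed
  have ne: "b1 \<noteq> b2" using b by auto
  show ?thesis
  proof (rule vec.dim_unique[of "{b1, b2}"])
    have "vec.independent ((\<lambda>b. b) ` {b1, b2})"
      by (rule independent_if_dual_vectors(2)[where e = "\<lambda>b. if b = b1 then i else axis 5 1"])
        (use b ne in auto)
    then show "vec.independent {b1, b2}" by simp
    show "tangent_plane p \<subseteq> vec.span {b1, b2}"
    proof
      fix v assume "v \<in> tangent_plane p"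
      then obtain c d where "v = c *s b1 + d *s b2" using span by blast
      then show "v \<in> vec.span {b1, b2}"
        by (auto intro: vec.span_add vec.span_scale vec.span_base)
    qed
  qed (use b ne in auto)
qed


section \<open>Limits of conormal lines and of tangent planes\<close>

lemma differential_poly_xyuvw:
  fixes p :: "'a::field_char_0 ^ 5"
  shows "differential poly_xyuvw p =
    vec5 (2 * (p $ 3 * p $ 1 + p $ 5 ^ 2 * p $ 2)) (2 * (p $ 5 ^ 2 * p $ 1 + p $ 4 * p $ 2))
      (p $ 1 ^ 2) (p $ 2 ^ 2) (4 * p $ 5 * p $ 1 * p $ 2)" (is "_ = ?d")
proof (rule differential_eqI)
  fix i :: 5
  let ?L = "\<lambda>k. [:p $ k, axis i 1 $ k:]"
  let ?q = "?L 3 * ?L 1 ^ 2 + smult 2 (?L 5 ^ 2 * ?L 1 * ?L 2) + ?L 4 * ?L 2 ^ 2"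
  show "poly ?q t = poly_xyuvw (p + t *s axis i 1)" for t
    by (simp add: poly_xyuvw_def Let_def algebra_simps)
  show "poly (pderiv ?q) 0 = ?d $ i"
    by (cases i rule: exhaust_5)
      (simp_all add: axis_def pderiv_add pderiv_mult pderiv_power pderiv_smult pderiv_pCons
        power2_eq_square algebra_simps)
qed

lemma Sing_poly_xyuvw: "Sing (poly_xyuvw :: 'a::field_char_0 ^ 5 \<Rightarrow> 'a) = coord_subspace {3, 4, 5}"
  unfolding Sing_def coord_subspace_345 differential_poly_xyuvw
  by (auto simp: vec_eq_5 poly_xyuvw_def Let_def)

abbreviation conormal_lines :: "(('a::field_char_0 ^ 5) \<times> ('a ^ 5) set) set" where
  "conormal_lines \<equiv>
     {(x, vec.span {differential poly_xyuvw x}) |x. differential poly_xyuvw x \<noteq> 0}"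

lemma conormal_limit_covector:
  fixes \<xi> :: "'a::field_char_0 ^ 5 \<Rightarrow> 'a ^ 5"
  assumes "zariski_limit conormal_lines a V" "\<And>i. (\<lambda>x. \<xi> x $ i) \<in> vpolys"
    "\<And>x. pairing (\<xi> x) (differential poly_xyuvw x) = 0" "m \<in> V"
  shows "pairing (\<xi> a) m = 0"
proof (rule zariski_limit_covector[OF assms(1,2) _ assms(4)])
  fix x :: "'a ^ 5" and U v assume "(x, U) \<in> conormal_lines" "v \<in> U"
  then obtain c where "v = c *s differential poly_xyuvw x"
    by (auto simp: vec.span_singleton)
  then show "pairing (\<xi> x) v = 0" using assms(3) by (simp add: pairing_scale_right)
qed

text \<open>
  The linear relations below are syzygies of the partial derivatives.  Their coefficients at the
  first two derivatives vanish on the singular locus, so that only a relation between the last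
  three coordinates is left in the limit.
\<close>

lemma conormal_limit_relations:
  fixes a :: "'a::field_char_0 ^ 5"
  assumes lim: "zariski_limit conormal_lines a V" and a: "a \<in> coord_subspace {3, 4, 5}"
    and m: "m \<in> V"
  shows "a $ 3 * m $ 3 = a $ 4 * m $ 4"
    "4 * a $ 5 ^ 3 * m $ 3 + a $ 4 * m $ 5 = 0"
    "4 * a $ 5 ^ 3 * m $ 4 + a $ 3 * m $ 5 = 0"
    "a $ 3 * a $ 4 \<noteq> a $ 5 ^ 4 \<Longrightarrow> m $ 3 = 0 \<and> m $ 4 = 0 \<and> m $ 5 = 0"
proof -
  have a12: "a $ 1 = 0" "a $ 2 = 0" using a by (simp_all add: coord_subspace_345)
  note syzygy = conormal_limit_covector[OF lim vpolys_vec5 _ m]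
  note eval = differential_poly_xyuvw pairing_5 a12 eval_nat_numeral algebra_simps
  have "2 * (a $ 3 * m $ 3 - a $ 4 * m $ 4) = 0"
    using syzygy[of "\<lambda>x. - x $ 1" "\<lambda>x. x $ 2" "\<lambda>x. 2 * x $ 3" "\<lambda>x. - (2 * x $ 4)" "\<lambda>_. 0"]
    by (simp add: eval polyfuns_intros)
  then show "a $ 3 * m $ 3 = a $ 4 * m $ 4" by simp
  show "4 * a $ 5 ^ 3 * m $ 3 + a $ 4 * m $ 5 = 0"
    using syzygy[of "\<lambda>_. 0" "\<lambda>x. - (2 * x $ 5 * x $ 1)" "\<lambda>x. 4 * x $ 5 ^ 3" "\<lambda>_. 0" "\<lambda>x. x $ 4"]
    by (simp add: eval polyfuns_intros)
  show "4 * a $ 5 ^ 3 * m $ 4 + a $ 3 * m $ 5 = 0"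
    using syzygy[of "\<lambda>x. - (2 * x $ 5 * x $ 2)" "\<lambda>_. 0" "\<lambda>_. 0" "\<lambda>x. 4 * x $ 5 ^ 3" "\<lambda>x. x $ 3"]
    by (simp add: eval polyfuns_intros)
  let ?\<Delta> = "\<lambda>x :: 'a ^ 5. x $ 3 * x $ 4 - x $ 5 ^ 4"
  assume "a $ 3 * a $ 4 \<noteq> a $ 5 ^ 4"
  then have nz: "2 * ?\<Delta> a \<noteq> 0" by simp
  have "2 * ?\<Delta> a * m $ 3 = 0"
    using syzygy[of "\<lambda>x. - (x $ 1 * x $ 4)" "\<lambda>x. x $ 1 * x $ 5 ^ 2" "\<lambda>x. 2 * ?\<Delta> x" "\<lambda>_. 0" "\<lambda>_. 0"]
    by (simp add: eval polyfuns_intros)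
  moreover have "2 * ?\<Delta> a * m $ 4 = 0"
    using syzygy[of "\<lambda>x. x $ 2 * x $ 5 ^ 2" "\<lambda>x. - (x $ 2 * x $ 3)" "\<lambda>_. 0" "\<lambda>x. 2 * ?\<Delta> x" "\<lambda>_. 0"]
    by (simp add: eval polyfuns_intros)
  moreover have "2 * ?\<Delta> a * m $ 5 = 0"
    using syzygy[of "\<lambda>x. 4 * x $ 5 ^ 3 * x $ 1" "\<lambda>x. - (4 * x $ 5 * x $ 3 * x $ 1)" "\<lambda>_. 0"
        "\<lambda>_. 0" "\<lambda>x. 2 * ?\<Delta> x"]
    by (simp add: eval polyfuns_intros)
  ultimately show "m $ 3 = 0 \<and> m $ 4 = 0 \<and> m $ 5 = 0" using nz by simp
qed

text \<open>
  The limit relations say that \<open>(m\<^sub>3, m\<^sub>4, m\<^sub>5)\<close> is proportional to the normal vector \<open>(v, u, -4w\<^sup>3)\<close> of the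
  surface.  Multiplying the pairing by \<open>u\<close> or by \<open>v\<close> makes them applicable, and one of the two is
  nonzero off the origin.
\<close>

lemma thom_surface:
  fixes a :: "'a::field_char_0 ^ 5"
  assumes lim: "zariski_limit conormal_lines a V" and a: "a \<in> toric_surface" "a \<noteq> 0"
  shows "annihilates V (tangent_plane a)"
  unfolding annihilates_def
proof (intro ballI)
  fix m p assume m: "m \<in> V" and p: "p \<in> tangent_plane a"
  let ?s = "m $ 3 * p $ 3 + m $ 4 * p $ 4 + m $ 5 * p $ 5"
  have "a \<in> coord_subspace {3, 4, 5}" using a(1) toric_surface_subset by blast
  note rel = conormal_limit_relations(1-3)[OF lim this m]
  have tan: "p $ 1 = 0" "p $ 2 = 0" "a $ 4 * p $ 3 + a $ 3 * p $ 4 = 4 * a $ 5 ^ 3 * p $ 5"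
    using p by (simp_all add: in_tangent_plane_iff)
  have "a $ 3 * ?s = 0"
  proof -
    have "a $ 3 * ?s = (a $ 3 * m $ 3) * p $ 3 + m $ 4 * (a $ 3 * p $ 4) + (a $ 3 * m $ 5) * p $ 5"
      by (simp add: algebra_simps)
    also have "\<dots> = m $ 4 * (a $ 4 * p $ 3 + a $ 3 * p $ 4) + (a $ 3 * m $ 5) * p $ 5"
      unfolding rel(1) by (simp add: algebra_simps)
    also have "\<dots> = (4 * a $ 5 ^ 3 * m $ 4 + a $ 3 * m $ 5) * p $ 5"
      unfolding tan(3) by (simp add: algebra_simps)
    finally show ?thesis using rel(3) by simp
  qed
  moreover have "a $ 4 * ?s = 0"
  proof -
    have "a $ 4 * ?s = m $ 3 * (a $ 4 * p $ 3) + (a $ 4 * m $ 4) * p $ 4 + (a $ 4 * m $ 5) * p $ 5"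
      by (simp add: algebra_simps)
    also have "\<dots> = m $ 3 * (a $ 4 * p $ 3 + a $ 3 * p $ 4) + (a $ 4 * m $ 5) * p $ 5"
      unfolding rel(1)[symmetric] by (simp add: algebra_simps)
    also have "\<dots> = (4 * a $ 5 ^ 3 * m $ 3 + a $ 4 * m $ 5) * p $ 5"
      unfolding tan(3) by (simp add: algebra_simps)
    finally show ?thesis using rel(2) by simp
  qed
  ultimately have "?s = 0" using toric_surface_nonzeroD[OF a] by auto
  then show "pairing m p = 0" by (simp add: pairing_5 tan(1,2))
qed

text \<open>
  At the origin all linear relations degenerate.  There the quadratic relation between the last three
  partial derivatives \<open>x\<^sup>2\<close>, \<open>y\<^sup>2\<close> and \<open>4wxy\<close> decides.
\<close>

lemma thom_axis:
  fixes a :: "'a::field_char_0 ^ 5"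
  assumes lim: "zariski_limit conormal_lines a V" and a: "a \<in> coord_subspace {5}"
  shows "annihilates V (coord_subspace {5})"
proof -
  have a0: "a $ 1 = 0" "a $ 2 = 0" "a $ 3 = 0" "a $ 4 = 0" using a by (simp_all add: coord_subspace_5)
  then have a345: "a \<in> coord_subspace {3, 4, 5}" by (simp add: coord_subspace_345)
  obtain N where N: "V = row_space N"
    "\<forall>h\<in>polyfuns vec_mat_coords. (\<forall>x M. (x, row_space M) \<in> conormal_lines
       \<longrightarrow> h (x, M) = 0) \<longrightarrow> h (a, N) = 0"
    using zariski_limit_relations[OF lim] .
  have "N $ i $ 5 = 0" for i
  proof -
    let ?h = "\<lambda>z :: ('a ^ 5) \<times> ('a ^ 5 ^ 5).
      (snd z $ i $ 5) ^ 2 - 16 * (fst z $ 5) ^ 2 * (snd z $ i $ 3 * snd z $ i $ 4)"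
    have "?h (a, N) = 0"
    proof (rule N(2)[rule_format])
      show "?h \<in> polyfuns vec_mat_coords"
        by (intro polyfuns_intros vec_mat_polys_entry vec_mat_polys_fst)
      fix x and M :: "'a ^ 5 ^ 5" assume "(x, row_space M) \<in> conormal_lines"
      then have "M $ i \<in> vec.span {differential poly_xyuvw x}"
        using row_in_row_space[of M i] by auto
      then obtain c where "M $ i = c *s differential poly_xyuvw x"
        by (auto simp: vec.span_singleton)
      then show "?h (x, M) = 0"
        by (simp add: differential_poly_xyuvw power2_eq_square)
    qed
    then have sq: "(N $ i $ 5) ^ 2 = 16 * a $ 5 ^ 2 * (N $ i $ 3 * N $ i $ 4)" by simp
    have "4 * a $ 5 ^ 3 * N $ i $ 3 = 0"
      using conormal_limit_relations(2)[OF lim a345, of "N $ i"] row_in_row_space[of N i] N(1) a0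
      by simp
    then have "a $ 5 ^ 2 * N $ i $ 3 = 0" by auto
    then show ?thesis using sq by auto
  qed
  then have "row_space N \<subseteq> {v. pairing (axis 5 1) v = 0}"
    by (intro row_space_subsetI subspace_pairing) (simp add: pairing_commute[of "axis 5 1"])
  then have "m $ 5 = 0" if "m \<in> V" for m
    using that N(1) by (auto simp: pairing_commute[of "axis 5 1"])
  then show ?thesis by (auto simp: annihilates_def pairing_5 coord_subspace_5)
qed

text \<open>
  At points other than the origin the inclusion is an equality for dimension reasons; at the
  origin the tangent plane is all of \<open>x = y = 0\<close> and the inclusion is proper.
\<close>

lemma tangent_plane_limit:
  fixes a :: "'a::field_char_0 ^ 5"
  assumes lim: "zariski_limit {(x, tangent_plane x) |x. x \<in> toric_surface - {0}} a W"
  shows "vec.dim W = 2" "W \<subseteq> tangent_plane a"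
proof -
  show "vec.dim W = 2"
    by (rule zariski_limit_dim[OF lim]) (auto simp: dim_tangent_plane)
  have "pairing (\<xi> a) w = 0" if "w \<in> W" "\<And>i. (\<lambda>x. \<xi> x $ i) \<in> vpolys"
    "\<And>x v. v \<in> tangent_plane x \<Longrightarrow> pairing (\<xi> x) v = 0" for \<xi> :: "'a ^ 5 \<Rightarrow> 'a ^ 5" and w
    by (rule zariski_limit_covector[OF lim that(2) _ that(1)]) (use that(3) in auto)
  note * = this
  show "W \<subseteq> tangent_plane a"
  proof
    fix w assume w: "w \<in> W"
    have "pairing (axis 1 1) w = 0" "pairing (axis 2 1) w = 0"
      by (rule *[OF w]; auto intro: polyfuns.const
          simp: in_tangent_plane_iff pairing_commute[of "axis _ 1"])+
    moreover have "pairing (conormal a) w = 0"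
    proof (rule *[OF w])
      show "(\<lambda>x. conormal x $ i) \<in> vpolys" for i
        unfolding conormal_def by (intro vpolys_vec5 polyfuns_intros)
    qed (simp add: tangent_plane_def)
    ultimately show "w \<in> tangent_plane a"
      by (simp add: tangent_plane_def coord_subspace_345 pairing_commute[of "axis _ 1"])
  qed
qed

text \<open>
  The cross product of two tangent vectors is a multiple of the normal vector \<open>(v, u, -4w\<^sup>3)\<close>, and the
  equation of the surface turns into a homogeneous equation for it.
\<close>

lemma tangent_plane_minors:
  fixes p :: "'a::field_char_0 ^ 5"
  assumes p: "p \<in> toric_surface" "p \<noteq> 0" and "a \<in> tangent_plane p" "b \<in> tangent_plane p"
  shows "(a $ 3 * b $ 4 - a $ 4 * b $ 3) ^ 2 =
    16 * p $ 5 ^ 2 * ((a $ 4 * b $ 5 - a $ 5 * b $ 4) * (a $ 5 * b $ 3 - a $ 3 * b $ 5))"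
proof -
  let ?n1 = "a $ 4 * b $ 5 - a $ 5 * b $ 4" and ?n2 = "a $ 5 * b $ 3 - a $ 3 * b $ 5"
    and ?n3 = "a $ 3 * b $ 4 - a $ 4 * b $ 3"
  have eq: "p $ 3 * p $ 4 = p $ 5 ^ 4" using p(1) by (simp add: toric_surface_def)
  have tan: "p $ 4 * a $ 3 + p $ 3 * a $ 4 = 4 * p $ 5 ^ 3 * a $ 5"
    "p $ 4 * b $ 3 + p $ 3 * b $ 4 = 4 * p $ 5 ^ 3 * b $ 5"
    using assms(3,4) by (simp_all add: in_tangent_plane_iff)
  have n12: "p $ 3 * ?n1 = p $ 4 * ?n2"
    and n32: "p $ 3 * ?n3 = - 4 * p $ 5 ^ 3 * ?n2" and n31: "p $ 4 * ?n3 = - 4 * p $ 5 ^ 3 * ?n1"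
    using tan by algebra+
  show ?thesis
  proof (cases "p $ 3 = 0")
    case False
    have "p $ 3 ^ 2 * ?n3 ^ 2 = (p $ 3 * ?n3) ^ 2" by (simp add: power_mult_distrib)
    also have "\<dots> = 16 * p $ 5 ^ 2 * (p $ 5 ^ 4 * ?n2) * ?n2"
      unfolding n32 by (simp add: eval_nat_numeral algebra_simps)
    also have "\<dots> = 16 * p $ 5 ^ 2 * p $ 3 * (p $ 4 * ?n2) * ?n2"
      unfolding eq[symmetric] by (simp only: ac_simps)
    also have "\<dots> = p $ 3 ^ 2 * (16 * p $ 5 ^ 2 * (?n1 * ?n2))"
      unfolding n12[symmetric] by (simp only: power2_eq_square ac_simps)
    finally show ?thesis using False by simp
  next
    case True
    then have "p $ 4 \<noteq> 0" "p $ 5 = 0"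
      using toric_surface_nonzeroD[OF p] eq by auto
    then show ?thesis using n31 by simp
  qed
qed

text \<open>
  At the origin the minors of the first two coordinates of a limit plane vanish, so the plane
  projects to a line in the \<open>(u, v)\<close>-plane and contains the \<open>w\<close>-axis.
\<close>

lemma whitney_origin:
  assumes lim: "zariski_limit {(x, tangent_plane x) |x. x \<in> toric_surface - {0}} (0 :: 'a::field_char_0 ^ 5) W"
  shows "coord_subspace {5} \<subseteq> W"
proof -
  have W: "vec.subspace W" by (rule zariski_limit_subspace[OF lim])
  obtain N where N: "W = row_space N"
    "\<forall>h\<in>polyfuns vec_mat_coords. (\<forall>x M. (x, row_space M) \<in> {(x, tangent_plane x) |x. x \<in> toric_surface - {0}}
       \<longrightarrow> h (x, M) = 0) \<longrightarrow> h (0, N) = 0"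
    using zariski_limit_relations[OF lim] .
  have minor: "N $ i $ 3 * N $ j $ 4 = N $ i $ 4 * N $ j $ 3" for i j
  proof -
    let ?m = "\<lambda>z :: ('a ^ 5) \<times> ('a ^ 5 ^ 5). \<lambda>k l. snd z $ i $ k * snd z $ j $ l - snd z $ i $ l * snd z $ j $ k"
    let ?h = "\<lambda>z. ?m z 3 4 ^ 2 - 16 * fst z $ 5 ^ 2 * (?m z 4 5 * ?m z 5 3)"
    have "?h (0, N) = 0"
    proof (rule N(2)[rule_format])
      show "?h \<in> polyfuns vec_mat_coords"
        by (intro polyfuns_intros vec_mat_polys_entry vec_mat_polys_fst)
      fix x and M :: "'a ^ 5 ^ 5"
      assume "(x, row_space M) \<in> {(x, tangent_plane x) |x. x \<in> toric_surface - {0}}"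
      then have "x \<in> toric_surface" "x \<noteq> 0" "M $ i \<in> tangent_plane x" "M $ j \<in> tangent_plane x"
        using row_in_row_space[of M] by auto
      from tangent_plane_minors[OF this] show "?h (x, M) = 0" by simp
    qed
    then show ?thesis by simp
  qed
  have row: "N $ i \<in> W" for i using N(1) row_in_row_space by simp
  have row12: "N $ i $ 1 = 0" "N $ i $ 2 = 0" for i
    using row[of i] tangent_plane_limit(2)[OF lim] by (auto simp: in_tangent_plane_iff)
  have "axis 5 1 \<in> W"
  proof (rule ccontr)
    assume no: "axis 5 1 \<notin> W"
    \<comment> \<open>Otherwise a vector of the plane is determined by its \<open>u\<close>- and \<open>v\<close>-components, and all rows are
      multiples of a single one.\<close>
    have vertical: "w = 0" if "w \<in> W" "w $ 1 = 0" "w $ 2 = 0" "w $ 3 = 0" "w $ 4 = 0" for w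
    proof -
      have w: "w = w $ 5 *s axis 5 1" using that by (simp add: vec_eq_5 axis_def)
      have "inverse (w $ 5) *s w \<in> W" using W that(1) by (rule vec.subspace_scale)
      moreover have "inverse (w $ 5) *s w = axis 5 1" if "w $ 5 \<noteq> 0"
        using that by (subst w) (simp add: vec_eq_5 axis_def)
      ultimately show ?thesis using no w by fastforce
    qed
    have "\<exists>b. \<forall>j. \<exists>c. N $ j = c *s b"
    proof (cases "\<exists>i. N $ i $ 3 \<noteq> 0 \<or> N $ i $ 4 \<noteq> 0")
      case True
      then obtain i where i: "N $ i $ 3 \<noteq> 0 \<or> N $ i $ 4 \<noteq> 0" by blast
      have "\<exists>c. N $ j = c *s N $ i" for j
      proof -
        obtain c where c: "N $ j $ 3 = c * N $ i $ 3" "N $ j $ 4 = c * N $ i $ 4"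
        proof (cases "N $ i $ 3 = 0")
          case False
          then show ?thesis using that[of "N $ j $ 3 / N $ i $ 3"] minor[of i j]
            by (simp add: field_simps)
        next
          case True
          then show ?thesis using that[of "N $ j $ 4 / N $ i $ 4"] minor[of i j] i by simp
        qed
        have "N $ j - c *s N $ i = 0"
          using c row12 row
          by (intro vertical vec.subspace_diff[OF W] vec.subspace_scale[OF W]) simp_all
        then show ?thesis by auto
      qed
      then show ?thesis by blast
    next
      case False
      then have "N $ j = 0 *s 0" for j using vertical[OF row] row12 by simp
      then show ?thesis by blast
    qed
    then obtain b where "\<And>j. \<exists>c. N $ j = c *s b" by blast
    then have "N $ j \<in> vec.span {b}" for j by (auto simp: vec.span_singleton)
    then have "W \<subseteq> vec.span {b}"
      unfolding N(1) by (intro row_space_subsetI) auto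
    then have "vec.dim W \<le> card {b}" by (intro vec.dim_le_card) simp_all
    then show False using tangent_plane_limit(1)[OF lim] by simp
  qed
  then have "c *s axis 5 1 \<in> W" for c by (rule vec.subspace_scale[OF W])
  moreover have "p = p $ 5 *s axis 5 1" if "p \<in> coord_subspace {5}" for p :: "'a ^ 5"
    using that by (simp add: coord_subspace_5 vec_eq_5 axis_def)
  ultimately show ?thesis by (metis subsetI)
qed


section \<open>A family of stratifications\<close>

text \<open>
  The stratum through the origin is the origin for \<open>I = {}\<close> and the \<open>w\<close>-axis for \<open>I = {5}\<close>; writing both as
  coordinate subspaces lets one proof serve both stratifications.
\<close>

definition toric_strata :: "5 set \<Rightarrow> ('a::field ^ 5) set set" where
  "toric_strata I =
     {coord_subspace {3, 4, 5} - (toric_surface \<union> coord_subspace I), toric_surface - {0}, coord_subspace I}"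

lemma surface_inter_axis: "toric_surface \<inter> coord_subspace {5} = {0}"
  by (auto simp: toric_surface_def coord_subspace_5 vec_eq_5)

lemma zero_in_toric_surface: "0 \<in> toric_surface"
  by (simp add: toric_surface_def)

lemma closedin_zero: "closedin zariski {0}"
  using closedin_coord_subspace[of "{}"] by (simp add: coord_subspace_empty)

lemma closedin_surface_Un_axis: "closedin zariski (toric_surface \<union> coord_subspace I)"
  by (intro closedin_Un closedin_toric_surface closedin_coord_subspace)

lemma generic_point_stratum:
  assumes "I \<subseteq> {5}"
  shows "vec5 0 0 1 1 0 \<in> coord_subspace {3, 4, 5} - (toric_surface \<union> coord_subspace I)"
proof -
  have "vec5 0 0 1 1 0 \<notin> coord_subspace {5}" by (simp add: coord_subspace_5)
  then have "vec5 0 0 1 1 0 \<notin> coord_subspace I" using coord_subspace_mono[OF assms] by blast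
  then show ?thesis by (simp add: toric_surface_def coord_subspace_345)
qed

lemma axis_in_toric_surface: "c *s axis 3 1 \<in> toric_surface" "c *s axis 4 1 \<in> toric_surface"
  by (simp_all add: toric_surface_def axis_def)

lemma partition_toric_strata:
  assumes "I \<subseteq> {5}"
  shows "partition_on (coord_subspace {3, 4, 5}) (toric_strata I :: ('a::field ^ 5) set set)"
proof (rule partition_onI)
  have E: "coord_subspace I \<subseteq> (coord_subspace {5} :: ('a ^ 5) set)"
    by (rule coord_subspace_mono[OF assms])
  have "coord_subspace I \<subseteq> (coord_subspace {3, 4, 5} :: ('a ^ 5) set)"
    by (rule coord_subspace_mono) (use assms in auto)
  then show "\<Union> (toric_strata I) = (coord_subspace {3, 4, 5} :: ('a ^ 5) set)"
    using toric_surface_subset zero_in_coord_subspace[of I] by (auto simp: toric_strata_def)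
  show "disjnt p q" if "p \<in> toric_strata I" "q \<in> toric_strata I" "p \<noteq> q" for p q :: "('a ^ 5) set"
    using that E surface_inter_axis by (auto simp: toric_strata_def disjnt_def)
  have "(1 :: 'a) *s axis 3 1 \<in> toric_surface - {0}" using axis_in_toric_surface(1)[of 1] by simp
  then show "{} \<notin> (toric_strata I :: ('a ^ 5) set set)"
    using generic_point_stratum[OF assms] zero_in_coord_subspace[of I]
    unfolding toric_strata_def by (metis empty_iff insert_iff)
qed

text \<open>
  All strata are smooth, and the open stratum and the stratum through the origin have constant tangent
  spaces.  The only incidence with content for Whitney's condition is that of the surface with the
  stratum through the origin, and it occurs at the origin alone.
\<close>

lemma TWG_toric_strata:
  fixes L :: "('a::field_char_0, 5) limit_notion"
  assumes "algebraic_limit L" and I: "I \<subseteq> {5}"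
  shows "TWG_stratification L poly_xyuvw (toric_strata I)"
proof -
  interpret algebraic_limit L by (rule assms(1))
  let ?K = "coord_subspace {3, 4, 5} :: ('a ^ 5) set" and ?E = "coord_subspace I :: ('a ^ 5) set"
  let ?X = "?K - (toric_surface \<union> ?E)" and ?D = "toric_surface - {0} :: ('a ^ 5) set"
  have cases: "thesis" if "S \<in> toric_strata I" "S = ?X \<Longrightarrow> thesis" "S = ?D \<Longrightarrow> thesis"
    "S = ?E \<Longrightarrow> thesis" for S thesis
    using that unfolding toric_strata_def by blast
  have E: "?E \<subseteq> coord_subspace {5}" by (rule coord_subspace_mono[OF I])
  have EK: "?E \<subseteq> ?K" by (rule coord_subspace_mono) (use I in auto)
  have DE: "a = 0" if "a \<in> toric_surface" "a \<in> ?E" for a :: "'a ^ 5"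
    using that E surface_inter_axis by blast
  have E_diff: "?E = ?E - {}" by simp
  have smooth_E: "nonsingular_point ?E x" "tangent_space ?E x = ?E" if "x \<in> ?E" for x
    using coord_subspace_diff_smooth[of "{}" x I] that by auto
  note smooth_X = coord_subspace_diff_smooth[OF closedin_surface_Un_axis[of I]]
  have smooth_D: "nonsingular_point ?D x" "tangent_space ?D x = tangent_plane x" if "x \<in> ?D" for x
    using toric_surface_diff_smooth[OF closedin_zero] that by auto
  have graph_X: "{(x, tangent_space ?X x) |x. x \<in> ?X} = {(x, ?K) |x. x \<in> ?X}"
    using smooth_X(2) by auto
  have graph_D: "{(x, tangent_space ?D x) |x. x \<in> ?D} = {(x, tangent_plane x) |x. x \<in> ?D}"
    using smooth_D(2) by auto
  have graph_E: "{(x, tangent_space ?E x) |x. x \<in> ?E} = {(x, ?E) |x. x \<in> ?E}"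
    using smooth_E(2) by auto
  show ?thesis
  proof (rule TWG_stratification_if_smooth)
    show "finite (toric_strata I)" by (simp add: toric_strata_def)
    show "partition_on (Sing poly_xyuvw) (toric_strata I :: ('a ^ 5) set set)"
      unfolding Sing_poly_xyuvw by (rule partition_toric_strata[OF I])
  next
    fix S :: "('a ^ 5) set" assume S: "S \<in> toric_strata I"
    obtain Z B where "closedin zariski Z" "closedin zariski B" "S = Z - B"
    proof (rule cases[OF S])
      assume "S = ?X"
      then show ?thesis using that closedin_coord_subspace closedin_surface_Un_axis by blast
    next
      assume "S = ?D"
      then show ?thesis using that closedin_toric_surface closedin_zero by blast
    next
      assume "S = ?E"
      then show ?thesis using that[of ?E "{}"] closedin_coord_subspace[of I] by simp
    qed
    then show "constructible S" "open_in_closure S"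
      using constructible_diff open_in_closure_diff by blast+
    show "nonsingular_point S x" if "x \<in> S" for x
      using cases[OF S] that smooth_X(1) smooth_D(1) smooth_E(1) by metis
  next
    fix S :: "('a ^ 5) set" and a W assume S: "S \<in> toric_strata I" "a \<in> S"
      and lim: "zariski_limit {(x, tangent_space S x) |x. x \<in> S} a W"
    show "W = tangent_space S a"
    proof (rule cases[OF S(1)])
      assume SX: "S = ?X"
      then show ?thesis using zariski_limit_constant[OF lim[unfolded SX graph_X]] smooth_X(2) S(2) by metis
    next
      assume SE: "S = ?E"
      then show ?thesis using zariski_limit_constant[OF lim[unfolded SE graph_E]] smooth_E(2) S(2) by metis
    next
      assume SD: "S = ?D"
      note lim' = lim[unfolded SD graph_D]
      have "W = tangent_plane a"
      proof (rule vec.subspace_dim_equal)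
        show "vec.subspace W" by (rule zariski_limit_subspace[OF lim])
        show "vec.dim (tangent_plane a) \<le> vec.dim W"
          using tangent_plane_limit(1)[OF lim'] dim_tangent_plane[of a] S(2) SD by simp
      qed (rule subspace_tangent_plane tangent_plane_limit(2)[OF lim'])+
      then show ?thesis using smooth_D(2) S(2) SD by metis
    qed
  next
    fix S :: "('a ^ 5) set" and a V assume S: "S \<in> toric_strata I" "a \<in> S" and lim: "zariski_limit conormal_lines a V"
    show "annihilates V (tangent_space S a)"
    proof (rule cases[OF S(1)])
      assume SX: "S = ?X"
      then have a: "a \<in> ?K" "a $ 3 * a $ 4 \<noteq> a $ 5 ^ 4"
        using S(2) by (auto simp: toric_surface_def coord_subspace_345)
      have "m $ 3 = 0" "m $ 4 = 0" "m $ 5 = 0" if "m \<in> V" for m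
        using conormal_limit_relations(4)[OF lim a(1) that a(2)] by auto
      then have "annihilates V ?K" by (simp add: annihilates_def pairing_5 coord_subspace_345)
      then show ?thesis using smooth_X(2) S(2) SX by metis
    next
      assume "S = ?D"
      then show ?thesis using thom_surface[OF lim] smooth_D(2) S(2) by auto
    next
      assume SE: "S = ?E"
      then have "annihilates V (coord_subspace {5})" using thom_axis[OF lim] S(2) E by blast
      then have "annihilates V ?E" using E unfolding annihilates_def by blast
      then show ?thesis using smooth_E(2) S(2) SE by metis
    qed
  next
    fix S S' :: "('a ^ 5) set" and a W assume S: "S \<in> toric_strata I" "S' \<in> toric_strata I" "S \<noteq> S'" "a \<in> S'"
      and lim: "zariski_limit {(x, tangent_space S x) |x. x \<in> S} a W"
    have tangent_K: "tangent_space S' a \<subseteq> ?K"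
      using cases[OF S(2)] S(4) smooth_X(2) smooth_D(2) smooth_E(2) EK
      by (metis (no_types, lifting) Int_lower1 order_refl tangent_plane_def)
    show "tangent_space S' a \<subseteq> W"
    proof (rule cases[OF S(1)])
      assume SX: "S = ?X"
      then show ?thesis using zariski_limit_constant[OF lim[unfolded SX graph_X]] tangent_K by simp
    next
      assume SD: "S = ?D"
      have a: "a \<in> toric_surface"
        by (rule zariski_limit_point_in_closed[OF lim closedin_toric_surface]) (use SD in auto)
      then have S': "S' = ?E" using cases[OF S(2)] S(3,4) SD by blast
      then have "a = 0" using DE a S(4) by blast
      then have "coord_subspace {5} \<subseteq> W" using whitney_origin lim[unfolded SD graph_D] by blast
      then show ?thesis using smooth_E(2) S' S(4) E by blast
    next
      assume SE: "S = ?E"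
      have "a \<in> ?E"
        by (rule zariski_limit_point_in_closed[OF lim closedin_coord_subspace]) (use SE in auto)
      then have False using cases[OF S(2)] S(3,4) SE DE by blast
      then show ?thesis ..
    qed
  qed
qed


section \<open>No stratification is universal\<close>

text \<open>
  Sets with a common open dense subset have the same closure, and each stratum of \<open>toric_strata I\<close> is
  open in an irreducible closed set.
\<close>

lemma component_closure:
  fixes L :: "('a::field_char_0, 5) limit_notion"
  assumes "algebraic_limit L" "universal_TWG_stratification L poly_xyuvw P"
    and S: "S \<in> P" "C \<in> components_of_constructible S" and I: "I \<subseteq> {5}"
  shows "zariski closure_of C \<in> {coord_subspace {3, 4, 5}, toric_surface, coord_subspace I}"
proof -
  obtain S' C' where S': "S' \<in> toric_strata I" "C' \<in> components_of_constructible S'"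
    and dense: "open_dense_in (C \<inter> C') C" "open_dense_in (C \<inter> C') C'"
    using assms(2) S TWG_toric_strata[OF assms(1) I] unfolding universal_TWG_stratification_def by blast
  have eq: "zariski closure_of C = zariski closure_of C'"
    by (rule open_dense_in_both_closures_eq[OF dense])
  have *: "zariski closure_of C' = Z" if "irreducible_set Z" "closedin zariski Z"
    "closedin zariski B" "\<not> Z \<subseteq> B" "S' = Z - B" for Z B
    using S'(2) components_of_diff_closed[OF that(1-4)] closure_of_diff_closed[OF that(1-4)] that(5) by simp
  consider "S' = coord_subspace {3, 4, 5} - (toric_surface \<union> coord_subspace I)"
    | "S' = toric_surface - {0}" | "S' = coord_subspace I - {}"
    using S'(1) unfolding toric_strata_def by auto
  then show ?thesis
  proof cases
    case 1
    then show ?thesis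
      using *[OF irreducible_coord_subspace closedin_coord_subspace closedin_surface_Un_axis]
        generic_point_stratum[OF I] eq by blast
  next
    case 2
    have "\<not> toric_surface \<subseteq> {0 :: 'a ^ 5}" using axis_in_toric_surface(1)[of "1::'a"] by auto
    then show ?thesis
      using *[OF irreducible_toric_surface closedin_toric_surface closedin_zero _ 2] eq by simp
  next
    case 3
    have "\<not> coord_subspace I \<subseteq> ({} :: ('a ^ 5) set)" using zero_in_coord_subspace by blast
    then show ?thesis
      using *[OF irreducible_coord_subspace closedin_coord_subspace closedin_empty _ 3] eq by simp
  qed
qed

text \<open>
  Only the singular locus and the surface occur among the closures of both stratifications.  As one
  contains the other, the closure of the stratum is the larger one that
  actually occurs among its components.
\<close>

lemma closure_of_universal_stratum:
  fixes L :: "('a::field_char_0, 5) limit_notion"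
  assumes "algebraic_limit L" "universal_TWG_stratification L poly_xyuvw P" "S \<in> P" "S \<noteq> {}"
  shows "zariski closure_of S = coord_subspace {3, 4, 5} \<or> zariski closure_of S = toric_surface"
proof -
  let ?K = "coord_subspace {3, 4, 5} :: ('a ^ 5) set"
  have "partition_on (Sing poly_xyuvw) P"
    using assms(2) by (simp add: universal_TWG_stratification_def TWG_stratification_def)
  then have "S \<subseteq> ?K" using assms(3) unfolding partition_on_def Sing_poly_xyuvw by blast
  then have SK: "zariski closure_of S \<subseteq> ?K"
    by (rule closure_of_minimal[OF _ closedin_coord_subspace])
  have comp: "zariski closure_of C = ?K \<or> zariski closure_of C = toric_surface"
    if "C \<in> components_of_constructible S" for C
  proof (rule ccontr)
    assume no: "\<not> ?thesis"
    have "zariski closure_of C = {0}"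
      using component_closure[OF assms(1-3) that, of "{}"] no by (simp add: coord_subspace_empty)
    moreover have "zariski closure_of C = coord_subspace {5}"
      using component_closure[OF assms(1-3) that, of "{5}"] no by simp
    moreover have "(axis 5 1 :: 'a ^ 5) \<in> coord_subspace {5}" by (simp add: axis_in_coord_subspace)
    ultimately have "(axis 5 1 :: 'a ^ 5) \<in> {0}" by simp
    then show False by simp
  qed
  have mono: "zariski closure_of C \<subseteq> zariski closure_of S" if "C \<in> components_of_constructible S" for C
    using that by (intro closure_of_mono) (auto simp: components_of_constructible_def)
  show ?thesis
  proof (cases "S \<subseteq> toric_surface")
    case True
    then have "zariski closure_of S \<subseteq> toric_surface"
      by (rule closure_of_minimal[OF _ closedin_toric_surface])
    moreover obtain x where "x \<in> S" using assms(4) by blast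
    then obtain C where C: "C \<in> components_of_constructible S" by (rule point_in_component)
    ultimately show ?thesis
      using comp[OF C] mono[OF C] SK by (metis subset_antisym)
  next
    case False
    then obtain x where "x \<in> S" "x \<notin> toric_surface" by blast
    then obtain C where C: "C \<in> components_of_constructible S" "x \<in> C"
      using point_in_component by metis
    have "x \<in> zariski closure_of C" using closure_of_subset[of C zariski] C(2) by auto
    then have "zariski closure_of C = ?K" using comp[OF C(1)] \<open>x \<notin> toric_surface\<close> by auto
    then show ?thesis using mono[OF C(1)] SK by blast
  qed
qed

text \<open>
  Along the \<open>x\<close>-axis the differential is \<open>x\<^sup>2 du\<close>, and \<open>du\<close> does not annihilate the tangent space.
\<close>

lemma not_thom_at_origin:
  fixes L :: "('a::field_char_0, 5) limit_notion"
  assumes "algebraic_limit L" and B: "closedin zariski B" "0 \<notin> B"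
    and regular: "G_regular L (coord_subspace {3, 4, 5} - B)"
  shows "\<not> thom_condition L poly_xyuvw (coord_subspace {3, 4, 5} - B)"
proof
  interpret algebraic_limit L by (rule assms(1))
  let ?K = "coord_subspace {3, 4, 5} :: ('a ^ 5) set"
  assume thom: "thom_condition L poly_xyuvw (?K - B)"
  have "L conormal_lines 0 (coord_subspace {3})"
    unfolding coord_subspace_eq_row_space
  proof (rule constant_on_line, unfold coord_subspace_eq_row_space[symmetric])
    show "openin zariski UNIV" using openin_topspace[of zariski] by simp
    fix t :: 'a assume t: "t \<noteq> 0"
    have d: "differential poly_xyuvw (t *s axis 1 1) = t ^ 2 *s axis 3 1"
      by (simp add: differential_poly_xyuvw vec_eq_5 axis_def)
    then have "differential poly_xyuvw (t *s axis 1 1) \<noteq> 0" using t by (simp add: vec_eq_5 axis_def)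
    moreover have "coord_subspace {3} = vec.span {t ^ 2 *s axis 3 1 :: 'a ^ 5}"
    proof
      have "v = (v $ 3 / t ^ 2) *s (t ^ 2 *s axis 3 1)" if "v \<in> coord_subspace {3}" for v :: "'a ^ 5"
        using that t by (simp add: coord_subspace_def forall_5 vec_eq_5 axis_def)
      then show "coord_subspace {3} \<subseteq> vec.span {t ^ 2 *s axis 3 1 :: 'a ^ 5}"
        unfolding vec.span_singleton by blast
      show "vec.span {t ^ 2 *s axis 3 1 :: 'a ^ 5} \<subseteq> coord_subspace {3}"
        by (rule vec.span_minimal[OF _ subspace_coord_subspace])
          (auto simp: coord_subspace_def axis_def)
    qed
    ultimately show "(t *s axis 1 1, coord_subspace {3}) \<in> (conormal_lines :: (('a ^ 5) \<times> ('a ^ 5) set) set)"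
      using d by auto
  qed simp
  moreover have "0 \<in> ?K - B" using B(2) zero_in_coord_subspace by blast
  ultimately have "annihilates (coord_subspace {3}) (gauss_tangent L (?K - B) 0)"
    using thom unfolding thom_condition_def by blast
  moreover have "gauss_tangent L (?K - B) 0 = ?K"
    using gauss_tangent_nonsingular[OF regular] coord_subspace_diff_smooth[OF B(1) \<open>0 \<in> ?K - B\<close>] by simp
  moreover have "(axis 3 1 :: 'a ^ 5) \<in> coord_subspace {3}" "(axis 3 1 :: 'a ^ 5) \<in> ?K"
    by (simp_all add: axis_in_coord_subspace)
  ultimately have "pairing (axis 3 1) (axis 3 (1::'a) :: 'a ^ 5) = 0"
    unfolding annihilates_def by blast
  moreover have "axis 3 (1::'a) $ (3::5) = 1" by (simp add: axis_def)
  ultimately show False by simp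
qed

lemma tangent_plane_on_axes:
  assumes "t \<noteq> (0::'a::field_char_0)"
  shows "tangent_plane (t *s axis 3 1) = coord_subspace {3, 5}"
    "tangent_plane (t *s axis 4 1) = coord_subspace {4, 5}"
  using assms by (auto simp: set_eq_iff in_tangent_plane_iff coord_subspace_def forall_5 axis_def)

text \<open>
  The tangent plane is constant along the \<open>u\<close>-axis and along the \<open>v\<close>-axis, with different values.
\<close>

lemma not_gauss_regular_at_origin:
  fixes L :: "('a::field_char_0, 5) limit_notion"
  assumes "algebraic_limit L" and B: "closedin zariski B" "0 \<notin> B"
  shows "\<not> G_regular L (toric_surface - B)"
proof
  interpret algebraic_limit L by (rule assms(1))
  let ?S = "toric_surface - B"
  assume regular: "G_regular L ?S"
  then obtain T where T: "gauss_extension L ?S T" unfolding G_regular_def by blast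
  have "0 \<in> ?S" using zero_in_toric_surface B(2) by blast
  have T0: "coord_subspace J = T 0" if "v \<noteq> 0" "\<And>t. t *s v \<in> toric_surface"
    "\<And>t. t \<noteq> 0 \<Longrightarrow> tangent_plane (t *s v) = coord_subspace J" for J and v :: "'a ^ 5"
  proof -
    have "L {(x, T x) |x. x \<in> ?S} 0 (coord_subspace J)"
      unfolding coord_subspace_eq_row_space
    proof (rule constant_on_line, unfold coord_subspace_eq_row_space[symmetric])
      show "openin zariski (- B)" by (rule openin_Compl[OF B(1)])
      show "0 \<in> - B" using B(2) by simp
      fix t assume t: "t \<noteq> 0" "t *s v \<in> - B"
      then have x: "t *s v \<in> ?S" "t *s v \<noteq> 0" using that(1,2) by (auto simp: vec_eq_iff)
      have "T (t *s v) = coord_subspace J"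
        using T toric_surface_diff_smooth[OF B(1) x] that(3)[OF t(1)] by (simp add: gauss_extension_def)
      then show "(t *s v, coord_subspace J) \<in> {(x, T x) |x. x \<in> ?S}" using x(1) by force
    qed
    then show ?thesis using T \<open>0 \<in> ?S\<close> unfolding gauss_extension_def by blast
  qed
  have "coord_subspace {3, 5} = (coord_subspace {4, 5} :: ('a ^ 5) set)"
    using T0[OF _ axis_in_toric_surface(1) tangent_plane_on_axes(1)]
      T0[OF _ axis_in_toric_surface(2) tangent_plane_on_axes(2)] by simp
  moreover have "(axis 3 1 :: 'a ^ 5) \<in> coord_subspace {3, 5}" "(axis 3 1 :: 'a ^ 5) \<notin> coord_subspace {4, 5}"
    by (auto simp: coord_subspace_def axis_def)
  ultimately show False by blast
qed

lemma no_universal_TWG_stratification: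
  fixes L :: "('a::field_char_0, 5) limit_notion"
  assumes "algebraic_limit L"
  shows "\<nexists>P. universal_TWG_stratification L poly_xyuvw P"
proof
  assume "\<exists>P. universal_TWG_stratification L poly_xyuvw P"
  then obtain P where P: "universal_TWG_stratification L poly_xyuvw P" ..
  then have TWG: "TWG_stratification L poly_xyuvw P" by (simp add: universal_TWG_stratification_def)
  then have "partition_on (coord_subspace {3, 4, 5}) P"
    unfolding TWG_stratification_def Sing_poly_xyuvw by blast
  from partition_onD1[OF this] have "0 \<in> \<Union> P"
    using zero_in_coord_subspace[of "{3, 4, 5}"] by metis
  then obtain S where S: "S \<in> P" "0 \<in> S" ..
  then have regular: "G_regular L S" and thom: "thom_condition L poly_xyuvw S"
    using TWG by (simp_all add: TWG_stratification_def)
  then obtain B where B: "closedin zariski B" "S = zariski closure_of S - B"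
    using open_in_closure_eq_diff by (metis G_regular_def)
  then have "0 \<notin> B" using S(2) by blast
  have "S \<noteq> {}" using S(2) by blast
  from closure_of_universal_stratum[OF assms P S(1) this]
  have "S = coord_subspace {3, 4, 5} - B \<or> S = toric_surface - B" using B(2) by metis
  then show False
    using not_thom_at_origin[OF assms B(1) \<open>0 \<notin> B\<close>] not_gauss_regular_at_origin[OF assms B(1) \<open>0 \<notin> B\<close>]
      regular thom by blast
qed

theorem proposition7p5:
  shows "(\<nexists>P. universal_TWG_stratification euclidean_limit (poly_xyuvw :: real ^ 5 \<Rightarrow> real) P) \<and>
    (\<nexists>P. universal_TWG_stratification euclidean_limit (poly_xyuvw :: complex ^ 5 \<Rightarrow> complex) P) \<and>
    (\<nexists>P. universal_TWG_stratification zariski_limit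
       (poly_xyuvw :: 'k::{alg_closed_field, field_char_0} ^ 5 \<Rightarrow> 'k) P)"
  by (intro conjI no_universal_TWG_stratification euclidean_limit_algebraic zariski_limit_algebraic)

end
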